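(* Let $h\in\mathbf{C}[X,Y]$ be a polynomial without constant term such that $\frac{\partial h}{\partial X}\neq 0$ and $\frac{\partial h}{\partial Y}\neq 0$ (as polynomials), $h$ is not divisible by $X^2$, and $h$ is not divisible by $Y^2$. Suppose additionally that at least one of the polygons $\mathcal{N}_h^{(\mathbf{r})}$, $\mathcal{N}_h^{(\mathbf{t})}$ has a segment which is not exceptional. Then $$l_\infty(\operatorname{grad} h)\leq \min\Big\{\inf_{S'}\alpha(S'),\ \inf_{S''}\beta(S'')\Big\}-1,$$ where $S'$ runs over all the segments of the right polygon $\mathcal{N}_h^{(\mathbf{r})}$ that are not exceptional (in the right polygon), and $S''$ runs over all the segments of the top polygon $\mathcal{N}_h^{(\mathbf{t})}$ that are not exceptional (in the top polygon). Moreover, if $h$ is nondegenerate at infinity, then equality holds.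
   Context: Conventions: $\inf\emptyset=+\infty$, $\sup\emptyset=-\infty$. For $z=(x,y)\in\mathbf{C}^2$, $|z|=\max\{|x|,|y|\}$. For a polynomial mapping $H=(f,g):\mathbf{C}^2\to\mathbf{C}^2$, the Łojasiewicz exponent at infinity $l_\infty(H)$ is the supremum of the set of real $\lambda$ for which there is $c>0$ with $|H(z)|\geq c|z|^\lambda$ for all $z$ with $|z|$ sufficiently large. $\operatorname{grad}h=(\frac{\partial h}{\partial X},\frac{\partial h}{\partial Y})$. For a nonzero $h=\sum h_{\alpha\beta}X^\alpha Y^\beta\in\mathbf{C}[X,Y]$: $\operatorname{supp}h=\{(\alpha,\beta):h_{\alpha\beta}\neq0\}$, and the Newton diagram $\Delta_h$ is the convex hull of $\operatorname{supp}h$. The right Newton polygon $\mathcal{N}_h^{(\mathbf{r})}$ is the set of one-dimensional faces of $\Delta_h$ on the right side of $\Delta_h$, joining the lines $\beta=\operatorname{ord}_Y h$ and $\beta=\deg_Y h$ (the minimal and maximal values of $\beta$ on $\operatorname{supp} h$); i.e. those segments which are the set of points of $\Delta_h$ where $\alpha+\theta\beta$ attains its maximum for some real $\theta$. The top Newton polygon $\mathcal{N}_h^{(\mathbf{t})}$ is the set of one-dimensional faces on the top of $\Delta_h$, joining the lines $\alpha=\operatorname{ord}_X h$ and $\alpha=\deg_X h$ (the minimal and maximal values of $\alpha$ on $\operatorname{supp}h$); i.e. those segments which are the set of points of $\Delta_h$ where $\theta\alpha+\beta$ attains its maximum for some real $\theta$. (In the degenerate case when $\Delta_h$ is itself a segment,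 that segment counts as a one-dimensional face.) The Newton polygon of $h$ at infinity is $\mathcal{N}_h^{(\mathbf{r})}\cup\mathcal{N}_h^{(\mathbf{t})}$. A segment of $\mathcal{N}_h^{(\mathbf{r})}$ is exceptional if it joins a point of the horizontal axis $\{\beta=0\}$ with a point of the form $(p,1)$. A segment of $\mathcal{N}_h^{(\mathbf{t})}$ is exceptional if it joins a point of the vertical axis $\{\alpha=0\}$ with a point of the form $(1,q)$. For a segment $S$ not parallel to the horizontal axis, $\alpha(S)$ is the abscissa of the point where the line determined by $S$ meets the horizontal axis. For $S$ not parallel to the vertical axis, $\beta(S)$ is the ordinate of the point where the line determined by $S$ meets the vertical axis. For a boundary segment $S$ of $\Delta_h$, $\operatorname{in}(h,S)=\sum_{(\alpha,\beta)\in S}h_{\alpha\beta}X^\alpha Y^\beta$. $h$ is nondegenerate on $S$ if the system $\frac{\partial}{\partial X}\operatorname{in}(h,S)=\frac{\partial}{\partial Y}\operatorname{in}(h,S)=0$ has no solutions in $(\mathbf{C}\setminus\{0\})\times(\mathbf{C}\setminus\{0\})$. $h$ is nondegenerate at infinity if it is nondegenerate on each segment of its Newton polygon at infinity. *)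

theory Defs
  imports "HOL-Analysis.Analysis" "HOL-Computational_Algebra.Polynomial"
begin

text \<open>
  A polynomial in \<open>\<complex>[X,Y]\<close> is represented as an element of \<open>\<complex>[X][Y]\<close>: the outer variable is \<open>Y\<close>,
  the inner one is \<open>X\<close>.
\<close>

type_synonym bipoly = "complex poly poly"

definition coeff2 :: "bipoly \<Rightarrow> nat \<Rightarrow> nat \<Rightarrow> complex"  \<comment> \<open>coefficient of \<open>X\<^sup>a Y\<^sup>b\<close>\<close>
  where "coeff2 h a b = coeff (coeff h b) a"

definition monom2 :: "complex \<Rightarrow> nat \<Rightarrow> nat \<Rightarrow> bipoly"
  where "monom2 c a b = monom (monom c a) b"

definition var_X :: bipoly where "var_X = monom2 1 1 0"

definition var_Y :: bipoly where "var_Y = monom2 1 0 1"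

definition eval2 :: "bipoly \<Rightarrow> complex \<times> complex \<Rightarrow> complex"
  where "eval2 h z = poly (poly h [:snd z:]) (fst z)"

definition pderiv_X :: "bipoly \<Rightarrow> bipoly" where "pderiv_X h = map_poly pderiv h"

definition pderiv_Y :: "bipoly \<Rightarrow> bipoly" where "pderiv_Y h = pderiv h"

definition grad :: "bipoly \<Rightarrow> bipoly \<times> bipoly" where "grad h = (pderiv_X h, pderiv_Y h)"

definition max_norm :: "complex \<times> complex \<Rightarrow> real"
  where "max_norm z = max (norm (fst z)) (norm (snd z))"

definition eval_map :: "bipoly \<times> bipoly \<Rightarrow> complex \<times> complex \<Rightarrow> complex \<times> complex"
  where "eval_map H z = (eval2 (fst H) z, eval2 (snd H) z)"

text \<open>The supremum is taken in \<^typ>\<open>ereal\<close>, where \<open>Sup {} = -\<infinity>\<close>.\<close>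

definition lojasiewicz_infty :: "bipoly \<times> bipoly \<Rightarrow> ereal" where
  "lojasiewicz_infty H =
     Sup {ereal l | l. \<exists>c>0. \<exists>R. \<forall>z. max_norm z \<ge> R \<longrightarrow>
                         max_norm (eval_map H z) \<ge> c * max_norm z powr l}"

definition supp :: "bipoly \<Rightarrow> (nat \<times> nat) set"
  where "supp h = {(a, b). coeff2 h a b \<noteq> 0}"

abbreviation real_point :: "nat \<times> nat \<Rightarrow> real \<times> real"
  where "real_point p \<equiv> (real (fst p), real (snd p))"

definition newton_diagram :: "bipoly \<Rightarrow> (real \<times> real) set"
  where "newton_diagram h = convex hull (real_point ` supp h)"

definition max_face :: "(real \<times> real) set \<Rightarrow> (real \<times> real \<Rightarrow> real) \<Rightarrow> (real \<times> real) set"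
  where "max_face D f = {p \<in> D. \<forall>q\<in>D. f q \<le> f p}"

definition right_polygon :: "bipoly \<Rightarrow> (real \<times> real) set set" where
  "right_polygon h =
     {S. aff_dim S = 1 \<and> (\<exists>\<theta>. S = max_face (newton_diagram h) (\<lambda>(a, b). a + \<theta> * b))}"

definition top_polygon :: "bipoly \<Rightarrow> (real \<times> real) set set" where
  "top_polygon h =
     {S. aff_dim S = 1 \<and> (\<exists>\<theta>. S = max_face (newton_diagram h) (\<lambda>(a, b). \<theta> * a + b))}"

definition exceptional_right :: "(real \<times> real) set \<Rightarrow> bool"
  where "exceptional_right S \<longleftrightarrow> (\<exists>a p. S = closed_segment (a, 0) (p, 1))"

definition exceptional_top :: "(real \<times> real) set \<Rightarrow> bool"
  where "exceptional_top S \<longleftrightarrow> (\<exists>b q. S = closed_segment (0, b) (1, q))"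

text \<open>
  The next two are meaningful for segments not parallel to the respective axis; the segments of the
  right (top) polygon are never horizontal (vertical).
\<close>

definition alpha :: "(real \<times> real) set \<Rightarrow> real"
  where "alpha S = (THE a. (a, 0) \<in> affine hull S)"

definition beta :: "(real \<times> real) set \<Rightarrow> real"
  where "beta S = (THE b. (0, b) \<in> affine hull S)"

definition initial_part :: "bipoly \<Rightarrow> (real \<times> real) set \<Rightarrow> bipoly" where
  "initial_part h S =
     (\<Sum>(a, b) \<in> {p \<in> supp h. real_point p \<in> S}. monom2 (coeff2 h a b) a b)"

definition nondegenerate_on :: "bipoly \<Rightarrow> (real \<times> real) set \<Rightarrow> bool" where
  "nondegenerate_on h S \<longleftrightarrow>
     \<not> (\<exists>x y. x \<noteq> 0 \<and> y \<noteq> 0 \<and>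
          eval2 (pderiv_X (initial_part h S)) (x, y) = 0 \<and>
          eval2 (pderiv_Y (initial_part h S)) (x, y) = 0)"

definition nondegenerate_at_infinity :: "bipoly \<Rightarrow> bool" where
  "nondegenerate_at_infinity h \<longleftrightarrow>
     (\<forall>S \<in> right_polygon h \<union> top_polygon h. nondegenerate_on h S)"

end

theory Submission
  imports Defs "HOL-Computational_Algebra.Fundamental_Theorem_Algebra"
begin

text \<open>
  The support of \<open>h\<close> is a finite set \<open>A\<close> of lattice points.  A segment of the right polygon is the set
  of points of the Newton diagram at which a functional \<open>\<alpha> + \<theta> \<beta>\<close> attains its maximum \<open>d\<close>, provided
  that this maximum is attained at points of \<open>A\<close> in two different rows, and then \<open>\<alpha>(S) = d\<close>.  It is
  exceptional exactly if all these points of \<open>A\<close> lie in the rows \<open>0\<close> and \<open>1\<close>.  Hence the numbers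
  \<open>\<alpha>(S)\<close> for nonexceptional \<open>S\<close> form the set \<open>intercepts A\<close>, and exchanging the two variables gives
  the numbers \<open>\<beta>(S)\<close> for the top polygon.  All the analysis is done for the right polygon.

  Upper bound (\<open>exponent_le_intercept\<close>).  For \<open>x = t\<close> and \<open>y = t\<^bsup>\<theta>\<^esup> w\<close> the polynomial \<open>h\<close> is \<open>t\<^sup>d\<close> times a
  polynomial in \<open>w\<close> with bounded coefficients.  If a point of \<open>A\<close> on the segment lies in a row
  \<open>n \<ge> 2\<close>, then in \<open>\<partial>h/\<partial>Y\<close> the coefficient of \<open>w\<^bsup>n-1\<^esup>\<close> stays away from \<open>0\<close> while the constant one is
  bounded, so that \<open>\<partial>h/\<partial>Y\<close> has a zero with \<open>w\<close> bounded.  There only \<open>\<partial>h/\<partial>X = O(t\<^bsup>d-1\<^esup>)\<close> is left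
  of the gradient.  Only zeros for single values of \<open>t\<close> are used, not a Puiseux branch.

  Lower bound (\<open>gradient_lower_bound\<close>).  By symmetry let \<open>|y| \<le> |x|\<close>.  At a given point either one
  monomial dominates all others, or two of them are comparable.  In the second case \<open>|y|\<close> is
  comparable with \<open>|x|\<^bsup>\<theta>\<^esup>\<close> for one of finitely many \<open>\<theta>\<close>, the two exponents lie on a segment, and
  nondegeneracy together with compactness of an annulus bounds the gradient from below
  (\<open>good_annulus\<close>).  In the first case a single monomial of \<open>\<partial>h/\<partial>X\<close> or \<open>\<partial>h/\<partial>Y\<close> does so, and it
  remains to compare its size with the intercepts of the neighbouring segments
  (\<open>good_upper_vertex\<close>, \<open>good_bottom_vertex\<close>).

  Exceptional segments do not contribute an intercept, so near them the gradient must be bounded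
  differently: there \<open>\<partial>h/\<partial>Y\<close> is of order \<open>|x|\<^sup>p\<close>, where \<open>(p, 1)\<close> is the upper end point.  That \<open>p\<close> is
  large enough is the combinatorial fact \<open>intercept_bound_row_one\<close>, and it is here that some
  segment must be nonexceptional.
\<close>

section \<open>Faces of a finite set of lattice points\<close>

definition support :: "(nat \<times> nat \<Rightarrow> complex) \<Rightarrow> (nat \<times> nat) set"
  where "support k = {q. k q \<noteq> 0}"

definition weight :: "real \<Rightarrow> nat \<times> nat \<Rightarrow> real"
  where "weight \<theta> q = real (fst q) + \<theta> * real (snd q)"

definition face :: "(nat \<times> nat) set \<Rightarrow> real \<Rightarrow> (nat \<times> nat) set"
  where "face A \<theta> = {v \<in> A. \<forall>q\<in>A. weight \<theta> q \<le> weight \<theta> v}"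

text \<open>
  The condition \<open>2 \<le> snd v\<close> singles out the nonexceptional segments among those that meet two rows.
\<close>

definition intercepts :: "(nat \<times> nat) set \<Rightarrow> real set" where
  "intercepts A =
     {weight \<theta> v | \<theta> v w. v \<in> face A \<theta> \<and> w \<in> face A \<theta> \<and> snd v \<noteq> snd w \<and> 2 \<le> snd v}"

lemma face_weight_eq: "v \<in> face A \<theta> \<Longrightarrow> w \<in> face A \<theta> \<Longrightarrow> weight \<theta> v = weight \<theta> w"
  by (force simp: face_def)

lemma face_subset: "v \<in> face A \<theta> \<Longrightarrow> v \<in> A"
  by (simp add: face_def)

lemma intercepts_face:
  assumes "v \<in> face A \<theta>" "w \<in> face A \<theta>" "snd v \<noteq> snd w" "u \<in> face A \<theta>" "2 \<le> snd u"
  shows "weight \<theta> v \<in> intercepts A"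
proof -
  obtain w' where w': "w' \<in> face A \<theta>" "snd u \<noteq> snd w'"
    using assms by (cases "snd u = snd v") auto
  have "weight \<theta> u \<in> intercepts A"
    unfolding intercepts_def using assms(4,5) w' by blast
  then show ?thesis using face_weight_eq[OF assms(1,4)] by simp
qed

lemma weight_shift:
  "weight \<theta>' v - weight \<theta>' u =
     (weight \<theta> v - weight \<theta> u) + (\<theta>' - \<theta>) * (real (snd v) - real (snd u))"
  by (simp add: weight_def algebra_simps)

text \<open>
  Rotate the supporting line about \<open>v\<close> until it first meets a point of a higher row.
\<close>

lemma face_above:
  assumes "finite A" "v \<in> face A \<theta>" "u \<in> A" "snd v < snd u"
  shows "\<exists>\<theta>'\<ge>\<theta>. v \<in> face A \<theta>' \<and> (\<exists>w\<in>face A \<theta>'. snd v < snd w)"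
proof -
  define B where "B = {u \<in> A. snd v < snd u}"
  \<comment> \<open>The value of \<open>\<theta>\<close> for which \<open>u\<close> and \<open>v\<close> have equal weight.\<close>
  define s where "s u = (real (fst v) - real (fst u)) / (real (snd u) - real (snd v))" for u
  have "u \<in> B" using assms(3,4) by (simp add: B_def)
  then have "B \<noteq> {}" by blast
  moreover have "finite B" using assms(1) by (simp add: B_def)
  ultimately have B: "finite B" "B \<noteq> {}" by blast+
  obtain w where w: "w \<in> B" "\<And>u. u \<in> B \<Longrightarrow> s w \<le> s u"
    using ex_min_if_finite[of "s ` B"] B by (metis arg_min_if_finite(1) arg_min_least)
  have s: "weight \<theta>' u \<le> weight \<theta>' v \<longleftrightarrow> \<theta>' \<le> s u" if "u \<in> B" for u \<theta>'
    using that by (auto simp: B_def s_def weight_def field_simps)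
  have s': "weight \<theta>' u = weight \<theta>' v \<longleftrightarrow> \<theta>' = s u" if "u \<in> B" for u \<theta>'
    using that by (auto simp: B_def s_def weight_def field_simps)
  have wA: "w \<in> A" "snd v < snd w" using w(1) by (auto simp: B_def)
  have ge: "\<theta> \<le> s w" using s[OF w(1)] assms(2) wA by (auto simp: face_def)
  have le: "weight (s w) q \<le> weight (s w) v" if "q \<in> A" for q
  proof (cases "snd v < snd q")
    case True
    then show ?thesis using s w(2) that by (auto simp: B_def)
  next
    case False
    have "0 \<le> (s w - \<theta>) * (real (snd v) - real (snd q))" using ge False by simp
    moreover have "weight \<theta> q \<le> weight \<theta> v" using assms(2) that by (auto simp: face_def)
    ultimately show ?thesis using weight_shift[of "s w" v q \<theta>] by linarith
  qed
  have "v \<in> face A (s w)" using le face_subset[OF assms(2)] by (auto simp: face_def)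
  moreover have "weight (s w) w = weight (s w) v" using s'[OF w(1)] by blast
  then have "w \<in> face A (s w)" using le wA by (simp add: face_def)
  ultimately show ?thesis using ge wA by blast
qed

text \<open>
  Rotate the supporting line about \<open>v\<close> the other way until it first meets a point of a lower row.
\<close>

lemma face_below:
  assumes "finite A" "v \<in> face A \<theta>" "u \<in> A" "snd u < snd v"
  shows "\<exists>\<theta>'\<le>\<theta>. v \<in> face A \<theta>' \<and> (\<exists>w\<in>face A \<theta>'. snd w < snd v)"
proof -
  define B where "B = {u \<in> A. snd u < snd v}"
  define s where "s u = (real (fst v) - real (fst u)) / (real (snd u) - real (snd v))" for u
  have "u \<in> B" using assms(3,4) by (simp add: B_def)
  then have "B \<noteq> {}" by blast
  moreover have "finite B" using assms(1) by (simp add: B_def)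
  ultimately have B: "finite B" "B \<noteq> {}" by blast+
  obtain w where w: "w \<in> B" "\<And>u. u \<in> B \<Longrightarrow> - s w \<le> - s u"
    using B by (metis arg_min_if_finite(1) arg_min_least[of B _ "\<lambda>u. - s u"])
  have s: "weight \<theta>' u \<le> weight \<theta>' v \<longleftrightarrow> s u \<le> \<theta>'" if "u \<in> B" for u \<theta>'
    using that by (auto simp: B_def s_def weight_def field_simps)
  have s': "weight \<theta>' u = weight \<theta>' v \<longleftrightarrow> \<theta>' = s u" if "u \<in> B" for u \<theta>'
    using that by (auto simp: B_def s_def weight_def field_simps)
  have wA: "w \<in> A" "snd w < snd v" using w(1) by (auto simp: B_def)
  have ge: "s w \<le> \<theta>" using s[OF w(1)] assms(2) wA by (auto simp: face_def)
  have le: "weight (s w) q \<le> weight (s w) v" if "q \<in> A" for q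
  proof (cases "snd q < snd v")
    case True
    then show ?thesis using s w(2) that by (auto simp: B_def)
  next
    case False
    have "0 \<le> (s w - \<theta>) * (real (snd v) - real (snd q))"
      using ge False by (intro mult_nonpos_nonpos) auto
    moreover have "weight \<theta> q \<le> weight \<theta> v" using assms(2) that by (auto simp: face_def)
    ultimately show ?thesis using weight_shift[of "s w" v q \<theta>] by linarith
  qed
  have "v \<in> face A (s w)" using le face_subset[OF assms(2)] by (auto simp: face_def)
  moreover have "weight (s w) w = weight (s w) v" using s'[OF w(1)] by blast
  then have "w \<in> face A (s w)" using le wA by (simp add: face_def)
  ultimately show ?thesis using ge wA by blast
qed

lemma weight_swap:
  "\<theta> \<noteq> 0 \<Longrightarrow> weight (1 / \<theta>) (prod.swap q) = weight \<theta> q / \<theta>"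
  by (simp add: weight_def field_simps)

lemma face_swap:
  assumes "v \<in> face A \<theta>" "0 < \<theta>"
  shows "prod.swap v \<in> face (prod.swap ` A) (1 / \<theta>)"
  using assms by (auto simp: face_def weight_swap divide_right_mono simp del: swap_simp)

text \<open>
  A segment with \<open>\<theta> > 0\<close> belongs to both polygons.  Dividing the equation
  \<open>\<alpha> + \<theta> \<beta> = d\<close> by \<open>\<theta>\<close> shows that its intercept on the vertical axis is \<open>d / \<theta>\<close>.
\<close>

lemma intercepts_swap:
  assumes "v \<in> face A \<theta>" "w \<in> face A \<theta>" "0 < \<theta>" "fst v \<noteq> fst w" "2 \<le> fst v"
  shows "weight \<theta> v / \<theta> \<in> intercepts (prod.swap ` A)"
proof -
  have "weight (1 / \<theta>) (prod.swap v) \<in> intercepts (prod.swap ` A)"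
    unfolding intercepts_def
    using face_swap[OF assms(1,3)] face_swap[OF assms(2,3)] assms(4,5)
    by (intro CollectI exI[of _ "1/\<theta>"] exI[of _ "prod.swap v"] exI[of _ "prod.swap w"]) auto
  then show ?thesis using assms(3) by (simp add: weight_swap)
qed

text \<open>
  If there are points above the row \<open>1\<close>, the segment that goes up from \<open>(p, 1)\<close> is nonexceptional; let it
  belong to \<open>\<theta>'\<close>.  For \<open>\<theta>' \<le> 1\<close> its intercept on the horizontal axis is \<open>p + \<theta>' \<le> p + 1\<close>.  For
  \<open>\<theta>' > 1\<close> it is also a nonexceptional segment of the top polygon, because then \<open>p \<ge> 2\<close>, and its
  intercept on the vertical axis is \<open>p / \<theta>' + 1 \<le> p + 1\<close>.

  If there are no such points, all of \<open>A\<close> lies in the rows \<open>0\<close> and \<open>1\<close>, so a nonexceptional segment can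
  only occur in the top polygon.  Either it is horizontal or falls to the left, with intercept at most
  \<open>1\<close>, or it joins the last points of the two rows, and then its intercept is at most \<open>p + 1\<close> because
  the difference of their abscissas is a positive integer.
\<close>

lemma intercept_bound_row_one:
  assumes fin: "finite A"
    and l1: "\<And>d. d \<in> intercepts A \<Longrightarrow> l \<le> d - 1"
    and l2: "\<And>d. d \<in> intercepts (prod.swap ` A) \<Longrightarrow> l \<le> d - 1"
    and ne: "intercepts A \<noteq> {} \<or> intercepts (prod.swap ` A) \<noteq> {}"
    and v: "(p, 1) \<in> face A \<theta>" and \<theta>: "\<theta> \<le> 1"
  shows "l \<le> real p"
proof (cases "\<exists>u\<in>A. 2 \<le> snd u")
  case True
  then obtain u where "u \<in> A" "2 \<le> snd u" by blast
  then obtain \<theta>' w where \<theta>': "(p, 1) \<in> face A \<theta>'" "w \<in> face A \<theta>'" "2 \<le> snd w"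
    using face_above[OF fin v, of u] by (auto simp: Suc_le_eq numeral_2_eq_2)
  show ?thesis
  proof (cases "\<theta>' \<le> 1")
    case True
    have "weight \<theta>' w \<in> intercepts A"
      using \<theta>' by (intro intercepts_face[of _ _ _ "(p, 1)"]) auto
    then have "l \<le> weight \<theta>' (p, 1) - 1" using l1 face_weight_eq[OF \<theta>'(2,1)] by auto
    then show ?thesis using True by (simp add: weight_def)
  next
    case False
    have eq: "real p + \<theta>' = real (fst w) + \<theta>' * real (snd w)"
      using face_weight_eq[OF \<theta>'(1,2)] by (simp add: weight_def)
    have "\<theta>' * 2 \<le> \<theta>' * real (snd w)" using False \<theta>'(3) by (intro mult_left_mono) auto
    then have "real p > real (fst w)" "real p > 1" using eq False by linarith+
    then have "weight \<theta>' (p, 1) / \<theta>' \<in> intercepts (prod.swap ` A)"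
      using False \<theta>' by (intro intercepts_swap[of _ _ _ w]) auto
    then have "l \<le> weight \<theta>' (p, 1) / \<theta>' - 1" by (rule l2)
    also have "\<dots> = real p / \<theta>'" using False by (simp add: weight_def field_simps)
    also have "\<dots> \<le> real p" using False by (simp add: divide_le_eq mult_le_cancel_left1)
    finally show ?thesis .
  qed
next
  case False
  \<comment> \<open>Now \<open>A\<close> lies in the rows \<open>0\<close> and \<open>1\<close>, and \<open>\<eta>\<close> belongs to a nonexceptional
    segment of the top polygon.\<close>
  then have "intercepts A = {}" by (auto simp: intercepts_def face_def)
  with ne obtain d where d: "d \<in> intercepts (prod.swap ` A)" by blast
  then obtain \<eta> v' w' where *: "v' \<in> face (prod.swap ` A) \<eta>" "w' \<in> face (prod.swap ` A) \<eta>"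
    "snd v' \<noteq> snd w'" "d = weight \<eta> v'"
    unfolding intercepts_def by blast
  have dw: "d = weight \<eta> w'" using * face_weight_eq by blast
  have A: "prod.swap v' \<in> A" "prod.swap w' \<in> A" using *(1,2) by (auto simp: face_def)
  have small: "fst v' \<le> 1" "fst w' \<le> 1" using A False by force+
  have row: "snd q \<le> p" if "prod.swap q \<in> A" "fst q = 1" for q
  proof -
    have "weight \<theta> (prod.swap q) \<le> weight \<theta> (p, 1)"
      using v that(1) unfolding face_def by blast
    then show ?thesis using that(2) by (simp add: weight_def)
  qed
  have "d \<le> real p + 1"
  proof (cases "\<eta> \<le> 0")
    case True
    then have "\<eta> * real (snd v') \<le> 0" by (simp add: mult_nonpos_nonneg)
    then show ?thesis using *(4) small(1) by (simp add: weight_def)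
  next
    case False
    have key: "d \<le> real p + 1"
      if "fst q = 1" "fst r = 0" "d = weight \<eta> q" "d = weight \<eta> r" "prod.swap q \<in> A" for q r
    proof -
      have eq: "\<eta> * (real (snd r) - real (snd q)) = 1"
        using that by (simp add: weight_def algebra_simps)
      \<comment> \<open>The abscissas of the end points are integers, so they differ by at least
        \<open>1\<close>, and hence \<open>\<eta> \<le> 1\<close>.\<close>
      then have "real (snd r) - real (snd q) > 0" using False by (smt (verit) mult_nonneg_nonpos)
      then have "Suc (snd q) \<le> snd r" by simp
      then have "real (snd r) - real (snd q) \<ge> 1" by linarith
      then have "\<eta> * 1 \<le> 1"
        using eq False mult_left_mono[of 1 "real (snd r) - real (snd q)" \<eta>] by linarith
      then have "\<eta> * real (snd q) \<le> real (snd q)" using mult_right_mono[of \<eta> 1 "real (snd q)"] by simp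
      then show ?thesis using row[OF that(5,1)] that(1,3) by (simp add: weight_def)
    qed
    have "fst v' \<noteq> fst w'"
      using dw *(3,4) False by (auto simp: weight_def)
    then consider "fst v' = 1" "fst w' = 0" | "fst w' = 1" "fst v' = 0" using small by linarith
    then show ?thesis using key *(4) dw A by cases blast+
  qed
  then show ?thesis using l2[OF d] by simp
qed

text \<open>
  Consider the segment that goes up from \<open>(a, 0)\<close>.  If it is nonexceptional in either polygon, its
  intercept there yields \<open>l \<le> a - 1\<close>.  For \<open>\<theta>' > 1\<close> it is nonexceptional in the top polygon, since then
  \<open>a \<ge> 2\<close>.  What remains is an exceptional segment with \<open>\<theta>' \<le> 1\<close>.
\<close>

lemma intercept_bound_row_zero:
  assumes fin: "finite A"
    and l1: "\<And>d. d \<in> intercepts A \<Longrightarrow> l \<le> d - 1"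
    and l2: "\<And>d. d \<in> intercepts (prod.swap ` A) \<Longrightarrow> l \<le> d - 1"
    and u: "u \<in> A" "1 \<le> snd u"
    and v: "(a, 0) \<in> face A \<theta>"
    and less: "\<not> l \<le> real a - 1"
  shows "\<exists>\<theta>'\<le>1. \<exists>p. (a, 0) \<in> face A \<theta>' \<and> (p, 1) \<in> face A \<theta>'"
proof -
  obtain \<theta>' w where \<theta>': "(a, 0) \<in> face A \<theta>'" "w \<in> face A \<theta>'" "1 \<le> snd w"
    using face_above[OF fin v, of u] u by (auto simp: Suc_le_eq)
  have no2: "\<not> 2 \<le> snd q" if "q \<in> face A \<theta>'" for q
  proof
    assume "2 \<le> snd q"
    then have "weight \<theta>' (a, 0) \<in> intercepts A"
      using \<theta>' that by (intro intercepts_face[of _ _ _ w q]) auto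
    from l1[OF this] show False using less by (simp add: weight_def)
  qed
  then have w1: "snd w = 1" using \<theta>'(2,3) no2[of w] by linarith
  have wp: "(fst w, 1) \<in> face A \<theta>'" using \<theta>'(2) w1 by (metis prod.collapse)
  have eq: "real a = real (fst w) + \<theta>'"
    using face_weight_eq[OF \<theta>'(1) wp] by (simp add: weight_def)
  have "\<theta>' \<le> 1"
  proof (rule ccontr)
    assume big: "\<not> \<theta>' \<le> 1"
    then have "weight \<theta>' (a, 0) / \<theta>' \<in> intercepts (prod.swap ` A)"
      using eq \<theta>' by (intro intercepts_swap[of _ _ _ w]) auto
    from l2[OF this] have "l \<le> real a / \<theta>' - 1" by (simp add: weight_def)
    moreover have "real a / \<theta>' \<le> real a" using big by (simp add: divide_le_eq mult_le_cancel_left1)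
    ultimately show False using less by linarith
  qed
  then show ?thesis using \<theta>'(1) wp by blast
qed

section \<open>Sums of monomials\<close>

definition mon :: "complex \<Rightarrow> complex \<Rightarrow> nat \<times> nat \<Rightarrow> real"
  where "mon x y q = norm x ^ fst q * norm y ^ snd q"

text \<open>
  The truncated subtraction in \<open>fst q - 1\<close> only matters where the factor \<open>of_nat (fst q)\<close> vanishes.
\<close>

definition partial_X :: "(nat \<times> nat \<Rightarrow> complex) \<Rightarrow> complex \<Rightarrow> complex \<Rightarrow> complex" where
  "partial_X k x y = (\<Sum>q\<in>support k. of_nat (fst q) * k q * x ^ (fst q - 1) * y ^ snd q)"

definition partial_Y :: "(nat \<times> nat \<Rightarrow> complex) \<Rightarrow> complex \<Rightarrow> complex \<Rightarrow> complex" where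
  "partial_Y k x y = (\<Sum>q\<in>support k. of_nat (snd q) * k q * x ^ fst q * y ^ (snd q - 1))"

lemma of_nat_power_pred: "x * (of_nat n * x ^ (n - 1)) = of_nat n * (x :: complex) ^ n"
  by (cases n) auto

text \<open>
  After multiplication by \<open>x\<close> the partial derivative is a combination of the monomials of the support
  itself, without shifted exponents, and can be estimated by their sizes.
\<close>

lemma euler_sum_X:
  "x * (\<Sum>q\<in>B. of_nat (fst q) * k q * x ^ (fst q - 1) * y ^ snd q) =
     (\<Sum>q\<in>B. of_nat (fst q) * k q * (x ^ fst q * (y :: complex) ^ snd q))"
  unfolding sum_distrib_left
proof (rule sum.cong[OF refl])
  fix q
  have "x * (of_nat (fst q) * k q * x ^ (fst q - 1) * y ^ snd q)
      = (x * (of_nat (fst q) * x ^ (fst q - 1))) * k q * y ^ snd q" by (simp add: ac_simps)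
  then show "x * (of_nat (fst q) * k q * x ^ (fst q - 1) * y ^ snd q)
      = of_nat (fst q) * k q * (x ^ fst q * y ^ snd q)"
    unfolding of_nat_power_pred by (simp add: ac_simps)
qed

lemma euler_sum_Y:
  "y * (\<Sum>q\<in>B. of_nat (snd q) * k q * x ^ fst q * y ^ (snd q - 1)) =
     (\<Sum>q\<in>B. of_nat (snd q) * k q * (x ^ fst q * (y :: complex) ^ snd q))"
  unfolding sum_distrib_left
proof (rule sum.cong[OF refl])
  fix q
  have "y * (of_nat (snd q) * k q * x ^ fst q * y ^ (snd q - 1))
      = (y * (of_nat (snd q) * y ^ (snd q - 1))) * k q * x ^ fst q" by (simp add: ac_simps)
  then show "y * (of_nat (snd q) * k q * x ^ fst q * y ^ (snd q - 1))
      = of_nat (snd q) * k q * (x ^ fst q * y ^ snd q)"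
    unfolding of_nat_power_pred by (simp add: ac_simps)
qed

lemmas euler_X = euler_sum_X[where B = "support k" and k = k for k, folded partial_X_def]
lemmas euler_Y = euler_sum_Y[where B = "support k" and k = k for k, folded partial_Y_def]

lemma mon_powr:
  assumes "0 < norm x" "norm y = norm x powr \<theta> * s"
  shows "mon x y q = norm x powr weight \<theta> q * s ^ snd q"
  using assms by (simp add: mon_def weight_def powr_add powr_realpow power_mult_distrib
      flip: powr_powr powr_realpow)

text \<open>
  The constant \<open>\<epsilon>\<close> depends on the coefficients only: with it all the other terms together are at most half
  of the dominant one.
\<close>

lemma dominant_term:
  fixes f :: "nat \<times> nat \<Rightarrow> complex"
  assumes "finite A" "v \<in> A" "f v \<noteq> 0"
  shows "\<exists>\<epsilon>>0. \<forall>x y. (\<forall>q\<in>A - {v}. f q \<noteq> 0 \<longrightarrow> mon x y q \<le> \<epsilon> * mon x y v) \<longrightarrow>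
           norm (f v) / 2 * mon x y v \<le> norm (\<Sum>q\<in>A. f q * (x ^ fst q * y ^ snd q))"
proof -
  define C where "C = 1 + (\<Sum>q\<in>A. norm (f q))"
  have C: "C \<ge> 1" by (simp add: C_def sum_nonneg)
  define \<epsilon> where "\<epsilon> = norm (f v) / (2 * C)"
  have "\<epsilon> > 0" using C assms(3) by (simp add: \<epsilon>_def)
  moreover have "norm (f v) / 2 * mon x y v \<le> norm (\<Sum>q\<in>A. f q * (x ^ fst q * y ^ snd q))"
    if small: "\<forall>q\<in>A - {v}. f q \<noteq> 0 \<longrightarrow> mon x y q \<le> \<epsilon> * mon x y v" for x y
  proof -
    let ?g = "\<lambda>q. f q * (x ^ fst q * y ^ snd q)"
    have ng: "norm (?g q) = norm (f q) * mon x y q" for q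
      by (simp add: mon_def norm_mult norm_power)
    have mv: "mon x y v \<ge> 0" by (simp add: mon_def)
    have "norm (sum ?g (A - {v})) \<le> (\<Sum>q\<in>A - {v}. norm (f q) * (\<epsilon> * mon x y v))"
    proof (rule sum_norm_le)
      fix q assume "q \<in> A - {v}"
      then show "norm (?g q) \<le> norm (f q) * (\<epsilon> * mon x y v)"
        unfolding ng using small by (cases "f q = 0") (auto intro: mult_left_mono)
    qed
    also have "\<dots> = (\<Sum>q\<in>A - {v}. norm (f q)) * (\<epsilon> * mon x y v)"
      by (simp add: sum_distrib_right)
    also have "\<dots> \<le> C * (\<epsilon> * mon x y v)"
    proof (rule mult_right_mono)
      show "(\<Sum>q\<in>A - {v}. norm (f q)) \<le> C"
        unfolding C_def using assms(1) by (smt (verit) Diff_subset norm_ge_zero sum_mono2)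
    qed (use mv \<open>\<epsilon> > 0\<close> in auto)
    also have "\<dots> = norm (f v) / 2 * mon x y v" using C by (simp add: \<epsilon>_def)
    finally have "norm (sum ?g (A - {v})) \<le> norm (f v) / 2 * mon x y v" .
    moreover have "sum ?g A = ?g v + sum ?g (A - {v})"
      using assms(1,2) by (rule sum.remove)
    moreover have "norm (?g v) = norm (f v) * mon x y v" by (rule ng)
    ultimately show ?thesis
      using norm_diff_ineq[of "?g v" "sum ?g (A - {v})"] by simp
  qed
  ultimately show ?thesis by blast
qed

lemma eventually_powr_greater:
  fixes e K :: real
  assumes "0 < e"
  shows "\<exists>R\<ge>1. \<forall>t\<ge>R. K < t powr e"
proof -
  let ?r = "(\<bar>K\<bar> + 1) powr (1 / e)"
  have "K < t powr e" if "max 1 ?r \<le> t" for t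
  proof -
    have "?r powr e \<le> t powr e" using that assms by (intro powr_mono2) auto
    moreover have "?r powr e = \<bar>K\<bar> + 1" using assms by (simp add: powr_powr)
    ultimately show ?thesis by linarith
  qed
  then show ?thesis by (intro exI[of _ "max 1 ?r"]) auto
qed

text \<open>
  In the region \<open>|y| = O(|x|\<^bsup>\<theta>\<^esup>)\<close> the monomials off the face are of smaller order than \<open>|x|\<^sup>d\<close>, and the
  sum over the face is quasihomogeneous, so its size is \<open>|x|\<^sup>d\<close> times its value at a point rescaled to
  \<open>|x| = 1\<close>.
\<close>

lemma face_approximation:
  fixes f :: "nat \<times> nat \<Rightarrow> complex"
  assumes fin: "finite A" and v: "v \<in> face A \<theta>" and "0 < \<epsilon>" and "0 < \<delta>"
  shows "\<exists>R\<ge>1. \<forall>x y. R \<le> norm x \<longrightarrow> norm y \<le> norm x powr \<theta> / \<epsilon> \<longrightarrow>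
    norm ((\<Sum>q\<in>A. f q * (x ^ fst q * y ^ snd q)) - of_real (norm x powr weight \<theta> v) *
      (\<Sum>q\<in>face A \<theta>. f q * ((x / of_real (norm x)) ^ fst q *
         (y / of_real (norm x powr \<theta>)) ^ snd q))) \<le> \<delta> * norm x powr weight \<theta> v"
proof -
  let ?F = "face A \<theta>" and ?d = "weight \<theta> v"
  define r where "r t = (\<Sum>q\<in>A - ?F. norm (f q) * (1 / \<epsilon>) ^ snd q * t powr (weight \<theta> q - ?d))" for t
  have neg: "weight \<theta> q - ?d < 0" if "q \<in> A - ?F" for q
    using that v by (fastforce simp: face_def)
  have "(r \<longlongrightarrow> (\<Sum>q\<in>A - ?F. norm (f q) * (1 / \<epsilon>) ^ snd q * 0)) at_top"
    unfolding r_def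
    by (intro tendsto_sum tendsto_mult tendsto_const tendsto_neg_powr filterlim_ident neg)
  then have "(r \<longlongrightarrow> 0) at_top" by simp
  then have "eventually (\<lambda>t. r t < \<delta>) at_top" using \<open>0 < \<delta>\<close> by (rule order_tendstoD)
  then obtain R where R: "\<And>t. t \<ge> R \<Longrightarrow> r t < \<delta>" by (auto simp: eventually_at_top_linorder)
  have "norm ((\<Sum>q\<in>A. f q * (x ^ fst q * y ^ snd q)) - of_real (norm x powr ?d) *
      (\<Sum>q\<in>?F. f q * ((x / of_real (norm x)) ^ fst q *
         (y / of_real (norm x powr \<theta>)) ^ snd q))) \<le> \<delta> * norm x powr ?d"
    if x: "max 1 R \<le> norm x" and y: "norm y \<le> norm x powr \<theta> / \<epsilon>" for x y
  proof -
    define t where "t = norm x"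
    have t: "t \<ge> 1" "r t < \<delta>" using x R by (auto simp: t_def)
    let ?g = "\<lambda>q. f q * (x ^ fst q * y ^ snd q)"
    have face: "of_real (t powr ?d) * (f q * ((x / of_real t) ^ fst q *
         (y / of_real (t powr \<theta>)) ^ snd q)) = ?g q" if "q \<in> ?F" for q
    proof -
      have "t powr ?d = t powr weight \<theta> q" using face_weight_eq[OF v that] by simp
      also have "\<dots> = t ^ fst q * (t powr \<theta>) ^ snd q"
        using t by (simp add: weight_def powr_add powr_realpow powr_powr[symmetric])
      finally have "t powr ?d = t ^ fst q * (t powr \<theta>) ^ snd q" .
      then show ?thesis using t by (simp add: power_divide)
    qed
    have "sum ?g A = sum ?g (A - ?F) + sum ?g ?F"
      using fin by (intro sum.subset_diff) (auto simp: face_def)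
    moreover have "of_real (t powr ?d) * (\<Sum>q\<in>?F. f q * ((x / of_real t) ^ fst q *
         (y / of_real (t powr \<theta>)) ^ snd q)) = sum ?g ?F"
      unfolding sum_distrib_left using face by (rule sum.cong[OF refl])
    ultimately have eq: "sum ?g A - of_real (t powr ?d) * (\<Sum>q\<in>?F. f q * ((x / of_real t) ^ fst q *
         (y / of_real (t powr \<theta>)) ^ snd q)) = sum ?g (A - ?F)" by simp
    have le: "norm (sum ?g (A - ?F)) \<le> r t * t powr ?d"
      unfolding r_def sum_distrib_right
    proof (rule sum_norm_le)
      fix q
      have "norm (?g q) = norm (f q) * (t ^ fst q * norm y ^ snd q)"
        by (simp add: norm_mult norm_power t_def)
      also have "\<dots> \<le> norm (f q) * (t ^ fst q * (t powr \<theta> / \<epsilon>) ^ snd q)"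
        using y t(1) by (intro mult_left_mono power_mono) (auto simp: t_def)
      also have "\<dots> = norm (f q) * (1 / \<epsilon>) ^ snd q * t powr weight \<theta> q"
        using t by (simp add: weight_def powr_add powr_realpow powr_powr[symmetric] power_divide)
      also have "t powr weight \<theta> q = t powr (weight \<theta> q - ?d) * t powr ?d"
        by (simp flip: powr_add)
      finally show "norm (?g q) \<le> norm (f q) * (1 / \<epsilon>) ^ snd q * t powr (weight \<theta> q - ?d) * t powr ?d"
        by (simp add: mult.assoc)
    qed
    have "r t * t powr ?d \<le> \<delta> * t powr ?d"
      using t by (intro mult_right_mono) auto
    then show ?thesis unfolding t_def[symmetric] eq using le by linarith
  qed
  then show ?thesis by (intro exI[of _ "max 1 R"]) auto
qed

section \<open>The lower bound for nondegenerate gradients\<close>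

text \<open>
  The number \<open>l\<close> is an exponent admitted by the intercepts of both polygons.  Nondegeneracy is stated
  with the logarithmic derivatives \<open>x \<partial>/\<partial>x\<close> and \<open>y \<partial>/\<partial>y\<close>, which have the same zeros as the partial
  derivatives where \<open>x y \<noteq> 0\<close>.
\<close>

locale nondegenerate_coefficients =
  fixes k :: "nat \<times> nat \<Rightarrow> complex" and l :: real
  assumes finite_support: "finite (support k)"
    and origin: "(0, 0) \<notin> support k"
    and low_row: "\<exists>q\<in>support k. snd q \<le> 1"
    and high_row: "\<exists>q\<in>support k. 1 \<le> snd q"
    and intercepts_ne:
      "intercepts (support k) \<noteq> {} \<or> intercepts (prod.swap ` support k) \<noteq> {}"
    and le_intercepts: "\<And>d. d \<in> intercepts (support k) \<Longrightarrow> l \<le> d - 1"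
    and le_swap_intercepts: "\<And>d. d \<in> intercepts (prod.swap ` support k) \<Longrightarrow> l \<le> d - 1"
    and nondegenerate:
      "\<And>\<theta> v w x y. \<lbrakk>v \<in> face (support k) \<theta>; w \<in> face (support k) \<theta>; snd v \<noteq> snd w; x \<noteq> 0; y \<noteq> 0\<rbrakk> \<Longrightarrow>
         (\<Sum>q\<in>face (support k) \<theta>. of_nat (fst q) * k q * (x ^ fst q * y ^ snd q)) \<noteq> 0 \<or>
         (\<Sum>q\<in>face (support k) \<theta>. of_nat (snd q) * k q * (x ^ fst q * y ^ snd q)) \<noteq> 0"
begin

text \<open>
  A region \<open>P\<close> is good if the wanted inequality holds in its part near infinity with \<open>0 < |y| \<le> |x|\<close>.
  The constants may depend on the region, as only finitely many regions are needed.  Points with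
  \<open>y = 0\<close> are left to a limit argument, so that \<open>|y|\<close> is always a power of \<open>|x|\<close>.
\<close>

definition good :: "(complex \<Rightarrow> complex \<Rightarrow> bool) \<Rightarrow> bool" where
  "good P \<longleftrightarrow> (\<exists>c>0. \<exists>R. \<forall>x y. R \<le> norm x \<longrightarrow> y \<noteq> 0 \<longrightarrow> norm y \<le> norm x \<longrightarrow> P x y \<longrightarrow>
     c * norm x powr l \<le> max (norm (partial_X k x y)) (norm (partial_Y k x y)))"

lemma goodI:
  assumes "0 < c"
    and "\<And>x y. \<lbrakk>1 < norm x; R \<le> norm x; y \<noteq> 0; norm y \<le> norm x; P x y\<rbrakk> \<Longrightarrow>
      c * norm x powr l \<le> norm (partial_X k x y) \<or> c * norm x powr l \<le> norm (partial_Y k x y)"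
  shows "good P"
  unfolding good_def
proof (rule exI[of _ c], intro conjI exI[of _ "max 2 R"] allI impI)
  fix x y :: complex
  assume "max 2 R \<le> norm x" "y \<noteq> 0" "norm y \<le> norm x" "P x y"
  then show "c * norm x powr l \<le> max (norm (partial_X k x y)) (norm (partial_Y k x y))"
    using assms(2)[of x y] by auto
qed (rule assms(1))

lemma good_vacuous:
  assumes "\<And>x y. \<lbrakk>1 < norm x; R \<le> norm x; y \<noteq> 0; norm y \<le> norm x; P x y\<rbrakk> \<Longrightarrow> False"
  shows "good P"
  by (rule goodI[where c = 1 and R = R]) (use assms in auto)

lemma good_mono:
  assumes "good Q" and "\<And>x y. \<lbrakk>1 < norm x; R \<le> norm x; y \<noteq> 0; norm y \<le> norm x; P x y\<rbrakk> \<Longrightarrow> Q x y"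
  shows "good P"
proof -
  obtain c R' where "c > 0" and c: "\<And>x y. \<lbrakk>R' \<le> norm x; y \<noteq> 0; norm y \<le> norm x; Q x y\<rbrakk> \<Longrightarrow>
     c * norm x powr l \<le> max (norm (partial_X k x y)) (norm (partial_Y k x y))"
    using assms(1) unfolding good_def by blast
  have "c * norm x powr l \<le> max (norm (partial_X k x y)) (norm (partial_Y k x y))"
    if "max 2 (max R R') \<le> norm x" "y \<noteq> 0" "norm y \<le> norm x" "P x y" for x y
    using that by (intro c assms(2)) auto
  then show ?thesis unfolding good_def using \<open>c > 0\<close> by blast
qed

lemma good_disj:
  assumes "good P" "good Q"
  shows "good (\<lambda>x y. P x y \<or> Q x y)"
proof -
  obtain c R where c: "c > 0" "\<And>x y. \<lbrakk>R \<le> norm x; y \<noteq> 0; norm y \<le> norm x; P x y\<rbrakk> \<Longrightarrow>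
     c * norm x powr l \<le> max (norm (partial_X k x y)) (norm (partial_Y k x y))"
    using assms(1) unfolding good_def by blast
  obtain c' R' where c': "c' > 0" "\<And>x y. \<lbrakk>R' \<le> norm x; y \<noteq> 0; norm y \<le> norm x; Q x y\<rbrakk> \<Longrightarrow>
     c' * norm x powr l \<le> max (norm (partial_X k x y)) (norm (partial_Y k x y))"
    using assms(2) unfolding good_def by blast
  have "min c c' * norm x powr l \<le> max (norm (partial_X k x y)) (norm (partial_Y k x y))"
    if "max R R' \<le> norm x" "y \<noteq> 0" "norm y \<le> norm x" "P x y \<or> Q x y" for x y
  proof -
    have "min c c' * norm x powr l \<le> c * norm x powr l" "min c c' * norm x powr l \<le> c' * norm x powr l"
      by (auto intro: mult_right_mono)
    then show ?thesis using c(2)[of x y] c'(2)[of x y] that by fastforce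
  qed
  moreover have "0 < min c c'" using c(1) c'(1) by simp
  ultimately show ?thesis unfolding good_def by blast
qed

lemma good_finite_disj:
  assumes "finite I" "\<And>i. i \<in> I \<Longrightarrow> good (P i)"
  shows "good (\<lambda>x y. \<exists>i\<in>I. P i x y)"
  using assms
proof (induction I rule: finite_induct)
  case empty
  then show ?case by (intro good_vacuous) auto
next
  case (insert i I)
  then have "good (\<lambda>x y. P i x y \<or> (\<exists>i\<in>I. P i x y))" by (intro good_disj) auto
  then show ?case by simp
qed

lemma good_mono_exponent:
  assumes "0 < c"
    and "\<And>x y. \<lbrakk>1 < norm x; R \<le> norm x; y \<noteq> 0; norm y \<le> norm x; P x y\<rbrakk> \<Longrightarrow> \<exists>e\<ge>l.
      c * norm x powr e \<le> norm (partial_X k x y) \<or> c * norm x powr e \<le> norm (partial_Y k x y)"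
  shows "good P"
proof (rule goodI[OF assms(1), of R])
  fix x y :: complex
  assume *: "1 < norm x" "R \<le> norm x" "y \<noteq> 0" "norm y \<le> norm x" "P x y"
  then obtain e where e: "l \<le> e"
    "c * norm x powr e \<le> norm (partial_X k x y) \<or> c * norm x powr e \<le> norm (partial_Y k x y)"
    using assms(2) by blast
  have "c * norm x powr l \<le> c * norm x powr e"
    using * e(1) assms(1) by (intro mult_left_mono powr_mono) auto
  then show "c * norm x powr l \<le> norm (partial_X k x y) \<or> c * norm x powr l \<le> norm (partial_Y k x y)"
    using e(2) by linarith
qed

lemma row_one_bound: "(p, 1) \<in> face (support k) \<theta> \<Longrightarrow> \<theta> \<le> 1 \<Longrightarrow> l \<le> real p"
  using intercept_bound_row_one[OF finite_support le_intercepts le_swap_intercepts intercepts_ne]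
  by blast

text \<open>
  In \<open>y \<partial>h/\<partial>y\<close> the row \<open>0\<close> has zero coefficients, the rows \<open>\<ge> 2\<close> are small in the given region, and
  \<open>(p, 1)\<close> is the last point of its own row.  So \<open>x\<^sup>p y\<close> dominates, and the gradient is at least of order \<open>|x|\<^sup>p\<close>.
\<close>

lemma good_row_one:
  assumes v: "(p, 1) \<in> face (support k) \<theta>" and "\<theta> \<le> 1"
  shows "\<exists>\<epsilon>>0. good (\<lambda>x y. \<forall>q\<in>support k. 2 \<le> snd q \<longrightarrow> mon x y q \<le> \<epsilon> * mon x y (p, 1))"
proof -
  have vA: "(p, 1) \<in> support k" using face_subset[OF v] .
  let ?f = "\<lambda>q. of_nat (snd q) * k q"
  have f: "?f (p, 1) \<noteq> 0" using vA by (simp add: support_def)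
  obtain \<epsilon> where "\<epsilon> > 0" and dom: "\<And>x y. \<forall>q\<in>support k - {(p, 1)}. ?f q \<noteq> 0 \<longrightarrow>
      mon x y q \<le> \<epsilon> * mon x y (p, 1) \<Longrightarrow> norm (?f (p, 1)) / 2 * mon x y (p, 1) \<le>
        norm (\<Sum>q\<in>support k. ?f q * (x ^ fst q * y ^ snd q))"
    using dominant_term[OF finite_support vA, of ?f] f by blast
  have "good (\<lambda>x y. \<forall>q\<in>support k. 2 \<le> snd q \<longrightarrow> mon x y q \<le> \<epsilon> * mon x y (p, 1))"
  proof (rule good_mono_exponent[of "norm (k (p, 1)) / 2" "1 / \<epsilon>"])
    fix x y :: complex
    assume x: "1 < norm x" "1 / \<epsilon> \<le> norm x" and y: "y \<noteq> 0"
      and small: "\<forall>q\<in>support k. 2 \<le> snd q \<longrightarrow> mon x y q \<le> \<epsilon> * mon x y (p, 1)"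
    have "mon x y q \<le> \<epsilon> * mon x y (p, 1)" if q: "q \<in> support k" "q \<noteq> (p, 1)" "?f q \<noteq> 0" for q
    proof (cases "2 \<le> snd q")
      case False
      then have q1: "snd q = 1" using q(3) by (cases "snd q") auto
      have "weight \<theta> q \<le> weight \<theta> (p, 1)" using v q(1) by (auto simp: face_def)
      then have "fst q < p" using q1 q(2) by (cases q) (auto simp: weight_def)
      then have "norm x ^ Suc (fst q) \<le> norm x ^ p" using x by (intro power_increasing) auto
      moreover have "1 \<le> \<epsilon> * norm x" using x(2) \<open>\<epsilon> > 0\<close> by (simp add: field_simps)
      then have "1 * norm x ^ fst q \<le> (\<epsilon> * norm x) * norm x ^ fst q" by (intro mult_right_mono) auto
      ultimately have "norm x ^ fst q \<le> \<epsilon> * norm x ^ p"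
        using \<open>\<epsilon> > 0\<close> by (smt (verit) mult.assoc mult.commute mult_left_mono power_Suc)
      then show ?thesis using q1 by (simp add: mon_def mult_right_mono flip: mult.assoc)
    qed (use small q in auto)
    then have "norm (?f (p, 1)) / 2 * mon x y (p, 1) \<le> norm (y * partial_Y k x y)"
      unfolding euler_Y by (intro dom) auto
    then have "norm (k (p, 1)) / 2 * norm x ^ p * norm y \<le> norm (partial_Y k x y) * norm y"
      by (simp add: mon_def norm_mult ac_simps)
    then have "norm (k (p, 1)) / 2 * norm x ^ p \<le> norm (partial_Y k x y)" using y by simp
    moreover have "norm x ^ p = norm x powr real p" using x by (subst powr_realpow) auto
    ultimately show "\<exists>e\<ge>l. norm (k (p, 1)) / 2 * norm x powr e \<le> norm (partial_X k x y) \<or>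
        norm (k (p, 1)) / 2 * norm x powr e \<le> norm (partial_Y k x y)"
      using row_one_bound[OF v assms(2)] by (metis)
  qed (use vA in \<open>auto simp: support_def\<close>)
  then show ?thesis using \<open>\<epsilon> > 0\<close> by blast
qed

text \<open>
  With \<open>\<theta> = log |y| / log |x|\<close> the size of a monomial is \<open>|x|\<close> to the power of its weight, so a largest
  monomial has largest weight.
\<close>

lemma dominant_point_in_face:
  assumes "1 < norm x" "y \<noteq> 0" "norm y \<le> norm x" "v \<in> support k"
    and "\<forall>q\<in>support k. mon x y q \<le> mon x y v"
  obtains \<theta> where "\<theta> \<le> 1" "norm y = norm x powr \<theta>" "v \<in> face (support k) \<theta>"
proof
  let ?\<theta> = "log (norm x) (norm y)"
  have x0: "0 < norm x" "norm x \<noteq> 1" "0 < norm y" using assms by auto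
  then show y: "norm y = norm x powr ?\<theta>" by (metis powr_log_cancel)
  show "?\<theta> \<le> 1" using assms by (simp add: log_le_one_cancel_iff)
  have "mon x y q = norm x powr weight ?\<theta> q" for q
    by (rule mon_powr[of x y ?\<theta> 1 q, unfolded mult_1_right power_one, OF x0(1) y])
  then show "v \<in> face (support k) ?\<theta>" using assms by (auto simp: face_def)
qed

text \<open>
  The monomial \<open>v\<close> also dominates in \<open>y \<partial>h/\<partial>y\<close>, so that \<open>\<partial>h/\<partial>Y\<close> has order \<open>|x|\<close> to the power
  \<open>weight \<theta> v - \<theta>\<close>.  For \<open>snd v \<ge> 2\<close> this is compared with the intercept of the segment going down from
  \<open>v\<close>, which exists because the support meets the row \<open>0\<close> or \<open>1\<close>; for \<open>snd v = 1\<close> it is at least \<open>l\<close>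
  by \<open>row_one_bound\<close>.
\<close>

lemma good_upper_vertex:
  assumes v: "v \<in> support k" "1 \<le> snd v"
  shows "\<exists>\<epsilon>>0. good (\<lambda>x y. (\<forall>q\<in>support k. mon x y q \<le> mon x y v) \<and>
      (\<forall>q\<in>support k - {v}. mon x y q \<le> \<epsilon> * mon x y v))"
proof -
  let ?f = "\<lambda>q. of_nat (snd q) * k q"
  have f: "?f v \<noteq> 0" using v by (simp add: support_def)
  obtain \<epsilon> where "\<epsilon> > 0" and dom: "\<And>x y. \<forall>q\<in>support k - {v}. ?f q \<noteq> 0 \<longrightarrow>
      mon x y q \<le> \<epsilon> * mon x y v \<Longrightarrow> norm (?f v) / 2 * mon x y v \<le>
        norm (\<Sum>q\<in>support k. ?f q * (x ^ fst q * y ^ snd q))"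
    using dominant_term[OF finite_support v(1), of ?f] f by blast
  have "good (\<lambda>x y. (\<forall>q\<in>support k. mon x y q \<le> mon x y v) \<and>
      (\<forall>q\<in>support k - {v}. mon x y q \<le> \<epsilon> * mon x y v))"
  proof (rule good_mono_exponent[of "norm (?f v) / 2"])
    fix x y :: complex
    assume x: "1 < norm x" and y: "y \<noteq> 0" "norm y \<le> norm x"
      and small: "(\<forall>q\<in>support k. mon x y q \<le> mon x y v) \<and>
        (\<forall>q\<in>support k - {v}. mon x y q \<le> \<epsilon> * mon x y v)"
    then obtain \<theta> where \<theta>: "\<theta> \<le> 1" "norm y = norm x powr \<theta>" "v \<in> face (support k) \<theta>"
      using dominant_point_in_face[OF x y v(1)] by blast
    have "0 < norm x" using x by linarith
    then have "mon x y v = norm x powr weight \<theta> v"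
      by (rule mon_powr[of x y \<theta> 1 v, unfolded mult_1_right power_one, OF _ \<theta>(2)])
    also have "\<dots> = norm x powr (weight \<theta> v - \<theta>) * norm y" unfolding \<theta>(2) by (simp flip: powr_add)
    finally have mon: "mon x y v = norm x powr (weight \<theta> v - \<theta>) * norm y" .
    have "norm (?f v) / 2 * mon x y v \<le> norm (y * partial_Y k x y)"
      unfolding euler_Y by (intro dom) (use small in blast)
    then have "norm (?f v) / 2 * norm x powr (weight \<theta> v - \<theta>) * norm y \<le>
        norm (partial_Y k x y) * norm y"
      unfolding mon by (simp add: norm_mult ac_simps)
    then have "norm (?f v) / 2 * norm x powr (weight \<theta> v - \<theta>) \<le> norm (partial_Y k x y)"
      using y by simp
    moreover have "l \<le> weight \<theta> v - \<theta>"
    proof (cases "snd v = 1")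
      case True
      then have "(fst v, 1) \<in> face (support k) \<theta>" using \<theta>(3) by (metis prod.collapse)
      then show ?thesis using row_one_bound[of "fst v" \<theta>] \<theta>(1) True by (simp add: weight_def)
    next
      case False
      then have v2: "2 \<le> snd v" using v(2) by linarith
      obtain u where "u \<in> support k" "snd u < snd v" using low_row v2 by fastforce
      then obtain \<theta>' w where \<theta>': "\<theta>' \<le> \<theta>" "v \<in> face (support k) \<theta>'" "w \<in> face (support k) \<theta>'"
          "snd w < snd v"
        using face_below[OF finite_support \<theta>(3)] by blast
      have "weight \<theta>' v \<in> intercepts (support k)"
        using \<theta>' v2 by (intro intercepts_face[of _ _ _ w v]) auto
      then have "l \<le> weight \<theta>' v - 1" by (rule le_intercepts)
      moreover have "\<theta>' * real (snd v) \<le> \<theta> * real (snd v)" using \<theta>'(1) by (intro mult_right_mono) auto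
      ultimately show ?thesis using \<theta>(1) by (simp add: weight_def)
    qed
    ultimately show "\<exists>e\<ge>l. norm (?f v) / 2 * norm x powr e \<le> norm (partial_X k x y) \<or>
        norm (?f v) / 2 * norm x powr e \<le> norm (partial_Y k x y)" by blast
  qed (use f in auto)
  then show ?thesis using \<open>\<epsilon> > 0\<close> by blast
qed

text \<open>
  If \<open>l \<le> fst v - 1\<close>, then \<open>\<partial>h/\<partial>X\<close> is large enough.  Otherwise the segment going up from \<open>v\<close> is
  exceptional, with upper end point \<open>(p, 1)\<close>; as \<open>x\<^sup>p y\<close> is small compared with the monomial \<open>v\<close>, the
  point is below the annulus of that segment, where \<open>x\<^sup>p y\<close> dominates all higher rows.
\<close>

lemma good_bottom_vertex:
  assumes v: "v \<in> support k" "snd v = 0"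
  shows "\<exists>\<epsilon>>0. good (\<lambda>x y. (\<forall>q\<in>support k. mon x y q \<le> mon x y v) \<and>
      (\<forall>q\<in>support k - {v}. mon x y q \<le> \<epsilon> * mon x y v))"
    (is "\<exists>\<epsilon>>0. good (?P \<epsilon>)")
proof (cases "l \<le> real (fst v) - 1")
  case True
  let ?f = "\<lambda>q. of_nat (fst q) * k q"
  have "fst v \<noteq> 0" using v origin by (metis prod.collapse)
  then have f: "?f v \<noteq> 0" using v by (simp add: support_def)
  obtain \<epsilon> where "\<epsilon> > 0" and dom: "\<And>x y. \<forall>q\<in>support k - {v}. ?f q \<noteq> 0 \<longrightarrow>
      mon x y q \<le> \<epsilon> * mon x y v \<Longrightarrow> norm (?f v) / 2 * mon x y v \<le>
        norm (\<Sum>q\<in>support k. ?f q * (x ^ fst q * y ^ snd q))"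
    using dominant_term[OF finite_support v(1), of ?f] f by blast
  have "good (?P \<epsilon>)"
  proof (rule good_mono_exponent[of "norm (?f v) / 2"])
    fix x y :: complex
    assume x: "1 < norm x" and small: "?P \<epsilon> x y"
    have "0 < norm x" using x by linarith
    then have "mon x y v = norm x powr real (fst v)" using v by (simp add: mon_def powr_realpow)
    also have "\<dots> = norm x powr (real (fst v) - 1) * norm x"
      using \<open>0 < norm x\<close> by (simp add: powr_diff)
    finally have mon: "mon x y v = norm x powr (real (fst v) - 1) * norm x" .
    have "norm (?f v) / 2 * mon x y v \<le> norm (x * partial_X k x y)"
      unfolding euler_X by (intro dom) (use small in blast)
    then have "norm (?f v) / 2 * norm x powr (real (fst v) - 1) * norm x \<le>
        norm (partial_X k x y) * norm x"
      unfolding mon by (simp add: norm_mult ac_simps)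
    then have "norm (?f v) / 2 * norm x powr (real (fst v) - 1) \<le> norm (partial_X k x y)"
      using x by (subst (asm) mult_le_cancel_right) auto
    then show "\<exists>e\<ge>l. norm (?f v) / 2 * norm x powr e \<le> norm (partial_X k x y) \<or>
        norm (?f v) / 2 * norm x powr e \<le> norm (partial_Y k x y)" using True by blast
  qed (use f in auto)
  then show ?thesis using \<open>\<epsilon> > 0\<close> by blast
next
  case False
  have vv: "v = (fst v, 0)" using v(2) by (metis prod.collapse)
  show ?thesis
  proof (cases "\<exists>\<theta>. v \<in> face (support k) \<theta>")
    case False
    then have "good (?P 1)"
      by (intro good_vacuous[of 1]) (use dominant_point_in_face v(1) in metis)
    then show ?thesis by (intro exI[of _ 1]) auto
  next
    case True
    then obtain \<theta> p where \<theta>: "\<theta> \<le> 1" "v \<in> face (support k) \<theta>" "(p, 1) \<in> face (support k) \<theta>"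
      using intercept_bound_row_zero[OF finite_support le_intercepts le_swap_intercepts, of _ "fst v"]
        high_row False vv by metis
    obtain \<epsilon> where "\<epsilon> > 0" and \<epsilon>: "good (\<lambda>x y. \<forall>q\<in>support k. 2 \<le> snd q \<longrightarrow>
        mon x y q \<le> \<epsilon> * mon x y (p, 1))"
      using good_row_one[OF \<theta>(3,1)] by blast
    let ?\<epsilon> = "min 1 \<epsilon>"
    have "good (?P ?\<epsilon>)"
    proof (rule good_mono[OF \<epsilon>, of 1], intro ballI impI)
      fix x y :: complex and q
      assume x: "1 < norm x" and y: "y \<noteq> 0" and small: "?P ?\<epsilon> x y"
        and q: "q \<in> support k" "2 \<le> snd q"
      \<comment> \<open>In terms of \<open>s\<close>, each row \<open>j\<close> carries a factor \<open>s\<^sup>j\<close>, and \<open>s \<le> \<epsilon>\<close> says that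
        the point lies below the annulus.\<close>
      define s where "s = norm y / norm x powr \<theta>"
      have "0 < norm x" using x by linarith
    then have s0: "0 < s" using y by (simp add: s_def)
      have s: "norm y = norm x powr \<theta> * s" using x by (cases "x = 0") (auto simp: s_def)
      have mon: "mon x y r = norm x powr weight \<theta> r * s ^ snd r" for r
        by (rule mon_powr[OF _ s]) (use x in linarith)
      have "(p, 1) \<in> support k - {v}" using face_subset[OF \<theta>(3)] vv by auto
      then have "mon x y (p, 1) \<le> ?\<epsilon> * mon x y v" using small by blast
      then have "norm x powr weight \<theta> v * s \<le> norm x powr weight \<theta> v * ?\<epsilon>"
        unfolding mon face_weight_eq[OF \<theta>(3,2)] using v(2) by (simp add: ac_simps)
      then have s\<epsilon>: "s \<le> ?\<epsilon>" using \<open>0 < norm x\<close> by simp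
      have "s ^ snd q \<le> s ^ 2" using s0 s\<epsilon> q(2) by (intro power_decreasing) auto
      also have "\<dots> \<le> \<epsilon> * s" using s0 s\<epsilon> by (simp add: power2_eq_square)
      finally have "s ^ snd q \<le> \<epsilon> * s" .
      moreover have "norm x powr weight \<theta> q \<le> norm x powr weight \<theta> (p, 1)"
        using \<theta>(3) q(1) x by (intro powr_mono) (auto simp: face_def)
      ultimately have "norm x powr weight \<theta> q * s ^ snd q \<le> norm x powr weight \<theta> (p, 1) * (\<epsilon> * s)"
        using s0 by (intro mult_mono) auto
      then show "mon x y q \<le> \<epsilon> * mon x y (p, 1)" unfolding mon by (simp add: ac_simps)
    qed
    then show ?thesis using \<open>\<epsilon> > 0\<close> by (intro exI[of _ ?\<epsilon>]) auto
  qed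
qed

text \<open>
  On a nonexceptional segment this is nondegeneracy and compactness.  On an exceptional one the rows
  \<open>\<ge> 2\<close> lie off the face, hence are of smaller order than \<open>x\<^sup>p y\<close>.
\<close>

lemma good_annulus:
  assumes "\<theta> \<le> 1" and v: "v \<in> face (support k) \<theta>" and w: "w \<in> face (support k) \<theta>"
    and vw: "snd v \<noteq> snd w" and "0 < \<epsilon>"
  shows "good (\<lambda>x y. \<epsilon> * norm x powr \<theta> \<le> norm y \<and> norm y \<le> norm x powr \<theta> / \<epsilon>)"
    (is "good ?P")
proof (cases "\<exists>u\<in>face (support k) \<theta>. 2 \<le> snd u")
  case True
  let ?d = "weight \<theta> v"
  have l: "l \<le> ?d - 1" using True intercepts_face[OF v w vw] le_intercepts by blast
  define E where "E f x y = (\<Sum>q\<in>face (support k) \<theta>. f q * (x ^ fst q * y ^ snd q))"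
    for f and x y :: complex
  let ?f = "\<lambda>q. of_nat (fst q) * k q" and ?g = "\<lambda>q. of_nat (snd q) * k q"
  \<comment> \<open>The range of \<open>(x / |x|, y / |x|\<^bsup>\<theta>\<^esup>)\<close> in the region.\<close>
  define K where "K = sphere (0::complex) 1 \<times> (cball (0::complex) (1 / \<epsilon>) - ball 0 \<epsilon>)"
  define G where "G z = max (norm (E ?f (fst z) (snd z))) (norm (E ?g (fst z) (snd z)))" for z
  have "compact K" unfolding K_def by (intro compact_Times compact_diff) auto
  moreover have "continuous_on K G" unfolding G_def E_def by (intro continuous_intros)
  ultimately have "\<exists>\<delta>>0. \<forall>z\<in>K. \<delta> \<le> G z"
  proof (cases "K = {}")
    case False
    then obtain z where z: "z \<in> K" "\<forall>z'\<in>K. G z \<le> G z'"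
      using continuous_attains_inf[OF \<open>compact K\<close> _ \<open>continuous_on K G\<close>] by blast
    have "fst z \<noteq> 0" "snd z \<noteq> 0" using z(1) \<open>0 < \<epsilon>\<close> by (auto simp: K_def)
    then have "0 < G z" using nondegenerate[OF v w vw] unfolding G_def E_def
      by (auto simp: less_max_iff_disj)
    then show ?thesis using z(2) by blast
  qed (auto intro: exI[of _ 1])
  then obtain \<delta> where "\<delta> > 0" and \<delta>: "\<And>z. z \<in> K \<Longrightarrow> \<delta> \<le> G z" by blast
  have \<delta>2: "0 < \<delta> / 2" using \<open>\<delta> > 0\<close> by simp
  obtain R1 where R1: "\<forall>x y. R1 \<le> norm x \<longrightarrow> norm y \<le> norm x powr \<theta> / \<epsilon> \<longrightarrow>
    norm (x * partial_X k x y - of_real (norm x powr ?d) *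
      E ?f (x / of_real (norm x)) (y / of_real (norm x powr \<theta>))) \<le> \<delta> / 2 * norm x powr ?d"
    using face_approximation[OF finite_support v \<open>0 < \<epsilon>\<close> \<delta>2, of ?f] unfolding euler_X E_def by blast
  obtain R2 where R2: "\<forall>x y. R2 \<le> norm x \<longrightarrow> norm y \<le> norm x powr \<theta> / \<epsilon> \<longrightarrow>
    norm (y * partial_Y k x y - of_real (norm x powr ?d) *
      E ?g (x / of_real (norm x)) (y / of_real (norm x powr \<theta>))) \<le> \<delta> / 2 * norm x powr ?d"
    using face_approximation[OF finite_support v \<open>0 < \<epsilon>\<close> \<delta>2, of ?g] unfolding euler_Y E_def by blast
  let ?c = "\<delta> / 2 * min 1 \<epsilon>"
  show ?thesis
  proof (rule good_mono_exponent[of ?c "max R1 R2"])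
    fix x y :: complex
    assume x: "1 < norm x" "max R1 R2 \<le> norm x" and y: "y \<noteq> 0" and P: "?P x y"
    define t where "t = norm x"
    have t: "1 < t" using x by (simp add: t_def)
    let ?u = "x / of_real t" and ?w = "y / of_real (t powr \<theta>)"
    have "(?u, ?w) \<in> K"
      using P t \<open>0 < \<epsilon>\<close> by (auto simp: K_def t_def norm_divide field_simps)
    then have "\<delta> \<le> G (?u, ?w)" by (rule \<delta>)
    then consider "\<delta> \<le> norm (E ?f ?u ?w)" | "\<delta> \<le> norm (E ?g ?u ?w)"
      unfolding G_def by fastforce
    then have "?c * t powr (?d - 1) \<le> norm (partial_X k x y) \<or> ?c * t powr (?d - 1) \<le> norm (partial_Y k x y)"
    proof cases
      case 1
      then have "t powr ?d * \<delta> \<le> norm (of_real (t powr ?d) * E ?f ?u ?w)"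
        using t by (simp add: norm_mult)
      moreover have "norm (x * partial_X k x y - of_real (t powr ?d) * E ?f ?u ?w) \<le> \<delta> / 2 * t powr ?d"
        unfolding t_def using R1 x P by auto
      ultimately have "\<delta> / 2 * t powr ?d \<le> norm (x * partial_X k x y)"
        using norm_triangle_ineq3[of "x * partial_X k x y" "of_real (t powr ?d) * E ?f ?u ?w"]
        by (simp add: field_simps abs_le_iff)
      moreover have "t powr ?d = t powr (?d - 1) * t" using t by (simp add: powr_diff)
      ultimately have "(\<delta> / 2 * t powr (?d - 1)) * t \<le> norm (partial_X k x y) * t"
        unfolding norm_mult t_def[symmetric] by (simp add: ac_simps)
      then have "\<delta> / 2 * t powr (?d - 1) \<le> norm (partial_X k x y)"
        using t by (subst (asm) mult_le_cancel_right) auto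
      moreover have "?c * t powr (?d - 1) \<le> \<delta> / 2 * t powr (?d - 1)"
        using \<open>\<delta> > 0\<close> by (intro mult_right_mono) auto
      ultimately show ?thesis by linarith
    next
      case 2
      then have "t powr ?d * \<delta> \<le> norm (of_real (t powr ?d) * E ?g ?u ?w)"
        using t by (simp add: norm_mult)
      moreover have "norm (y * partial_Y k x y - of_real (t powr ?d) * E ?g ?u ?w) \<le> \<delta> / 2 * t powr ?d"
        unfolding t_def using R2 x P by auto
      ultimately have "\<delta> / 2 * t powr ?d \<le> norm (y * partial_Y k x y)"
        using norm_triangle_ineq3[of "y * partial_Y k x y" "of_real (t powr ?d) * E ?g ?u ?w"]
        by (simp add: field_simps abs_le_iff)
      moreover have "?c * t powr (?d - 1) * norm y \<le> \<delta> / 2 * t powr ?d"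
      proof -
        have le: "?c * t powr (?d - 1) \<le> \<delta> / 2 * \<epsilon> * t powr (?d - \<theta>)"
          using \<open>\<delta> > 0\<close> \<open>0 < \<epsilon>\<close> t \<open>\<theta> \<le> 1\<close> by (intro mult_mono powr_mono) auto
        then have "?c * t powr (?d - 1) * norm y \<le> \<delta> / 2 * \<epsilon> * t powr (?d - \<theta>) * (t powr \<theta> / \<epsilon>)"
          using P \<open>\<delta> > 0\<close> \<open>0 < \<epsilon>\<close> by (intro mult_mono[OF le]) (auto simp: t_def)
        also have "\<dots> = \<delta> / 2 * (t powr (?d - \<theta>) * t powr \<theta>)" using \<open>0 < \<epsilon>\<close> by simp
        also have "t powr (?d - \<theta>) * t powr \<theta> = t powr ?d" by (simp flip: powr_add)
        finally show ?thesis .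
      qed
      ultimately have "(?c * t powr (?d - 1)) * norm y \<le> norm (partial_Y k x y) * norm y"
        by (simp add: norm_mult ac_simps)
      then show ?thesis using y by (subst (asm) mult_le_cancel_right) auto
    qed
    then show "\<exists>e\<ge>l. ?c * norm x powr e \<le> norm (partial_X k x y) \<or>
        ?c * norm x powr e \<le> norm (partial_Y k x y)" using l unfolding t_def by blast
  qed (use \<open>\<delta> > 0\<close> \<open>0 < \<epsilon>\<close> in auto)
next
  case False
  have "snd v < 2" "snd w < 2" using False v w by (auto simp: not_le)
  then have "snd v = 1 \<or> snd w = 1" using vw by linarith
  then obtain p where p: "(p, 1) \<in> face (support k) \<theta>"
  proof
    assume "snd v = 1"
    then show ?thesis using that[of "fst v"] v by (cases v) simp
  next
    assume "snd w = 1"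
    then show ?thesis using that[of "fst w"] w by (cases w) simp
  qed
  obtain \<eta> where "\<eta> > 0" and \<eta>: "good (\<lambda>x y. \<forall>q\<in>support k. 2 \<le> snd q \<longrightarrow>
      mon x y q \<le> \<eta> * mon x y (p, 1))"
    using good_row_one[OF p \<open>\<theta> \<le> 1\<close>] by blast
  let ?d = "weight \<theta> (p, 1)"
  let ?B = "{q \<in> support k. 2 \<le> snd q}"
  have "\<exists>R\<ge>1. \<forall>t\<ge>R. 1 / (\<eta> * \<epsilon> ^ (snd q - 1)) < t powr (?d - weight \<theta> q)" if "q \<in> ?B" for q
  proof (rule eventually_powr_greater)
    have "q \<notin> face (support k) \<theta>" "q \<in> support k" using False that by auto
    then show "0 < ?d - weight \<theta> q" using p by (fastforce simp: face_def)
  qed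
  then have "\<forall>q\<in>?B. \<exists>R. \<forall>t\<ge>R. 1 / (\<eta> * \<epsilon> ^ (snd q - 1)) < t powr (?d - weight \<theta> q)" by blast
  from bchoice[OF this] obtain R where R: "\<And>q t. q \<in> ?B \<Longrightarrow> R q \<le> t \<Longrightarrow>
      1 / (\<eta> * \<epsilon> ^ (snd q - 1)) < t powr (?d - weight \<theta> q)" by blast
  have "finite ?B" using finite_support by simp
  define R0 where "R0 = Max (R ` ?B)"
  have R0: "R q \<le> R0" if "q \<in> ?B" for q
    unfolding R0_def using \<open>finite ?B\<close> that by (intro Max_ge) auto
  show ?thesis
  proof (rule good_mono[OF \<eta>, of R0], intro ballI impI)
    fix x y :: complex and q
    assume x: "1 < norm x" "R0 \<le> norm x" and y: "y \<noteq> 0" and P: "?P x y"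
      and q: "q \<in> support k" "2 \<le> snd q"
    define s where "s = norm y / norm x powr \<theta>"
    have "0 < norm x" using x by linarith
    then have s0: "0 < s" using y by (simp add: s_def)
    have s: "norm y = norm x powr \<theta> * s" using x by (cases "x = 0") (auto simp: s_def)
    have s\<epsilon>: "s \<le> 1 / \<epsilon>" using P \<open>0 < norm x\<close> \<open>0 < \<epsilon>\<close>
      by (simp add: s_def divide_le_eq)
    have mon: "mon x y r = norm x powr weight \<theta> r * s ^ snd r" for r
      by (rule mon_powr[OF _ s]) (use x in linarith)
    have "1 / (\<eta> * \<epsilon> ^ (snd q - 1)) \<le> norm x powr (?d - weight \<theta> q)"
      using R[of q "norm x"] R0[of q] q x by force
    then have "1 / \<epsilon> ^ (snd q - 1) \<le> \<eta> * norm x powr (?d - weight \<theta> q)"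
      using \<open>\<eta> > 0\<close> \<open>0 < \<epsilon>\<close> by (simp add: field_simps)
    moreover have "s ^ (snd q - 1) \<le> (1 / \<epsilon>) ^ (snd q - 1)" using s0 s\<epsilon> by (intro power_mono) auto
    ultimately have "s ^ (snd q - 1) \<le> \<eta> * norm x powr (?d - weight \<theta> q)"
      by (simp add: power_one_over)
    then have "norm x powr weight \<theta> q * s * s ^ (snd q - 1) \<le>
        norm x powr weight \<theta> q * s * (\<eta> * norm x powr (?d - weight \<theta> q))"
      using s0 by (intro mult_left_mono) auto
    also have "\<dots> = \<eta> * ((norm x powr weight \<theta> q * norm x powr (?d - weight \<theta> q)) * s)" by simp
    also have "norm x powr weight \<theta> q * norm x powr (?d - weight \<theta> q) = norm x powr ?d"
      by (simp flip: powr_add)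
    also have "norm x powr weight \<theta> q * s * s ^ (snd q - 1) = norm x powr weight \<theta> q * s ^ snd q"
      using q(2) by (cases "snd q") auto
    finally show "mon x y q \<le> \<eta> * mon x y (p, 1)" unfolding mon by simp
  qed
qed

lemma good_vertex:
  assumes "v \<in> support k"
  shows "\<exists>\<epsilon>>0. good (\<lambda>x y. (\<forall>q\<in>support k. mon x y q \<le> mon x y v) \<and>
      (\<forall>q\<in>support k - {v}. mon x y q \<le> \<epsilon> * mon x y v))"
proof (cases "snd v = 0")
  case True
  then show ?thesis by (rule good_bottom_vertex[OF assms])
next
  case False
  then have "1 \<le> snd v" by simp
  then show ?thesis by (rule good_upper_vertex[OF assms])
qed

text \<open>
  Comparability of the two monomials confines \<open>|y|\<close> to an annulus around \<open>|x|\<^bsup>\<theta>\<^esup>\<close>, where \<open>\<theta>\<close> makes their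
  weights equal.  Far out in this annulus \<open>\<theta> > 1\<close> contradicts \<open>|y| \<le> |x|\<close>, and a point of larger weight
  would have a larger monomial than \<open>v\<close>; so the pair lies on a segment, unless the region is bounded.
\<close>

lemma good_comparable_pair:
  assumes v: "v \<in> support k" and q: "q \<in> support k" and "q \<noteq> v" and \<epsilon>: "0 < \<epsilon>" "\<epsilon> \<le> 1"
  shows "good (\<lambda>x y. (\<forall>p\<in>support k. mon x y p \<le> mon x y v) \<and> \<epsilon> * mon x y v < mon x y q)"
    (is "good ?P")
proof (cases "snd q = snd v")
  case True
  show ?thesis
  proof (rule good_vacuous[of "1 / \<epsilon>"])
    fix x y :: complex
    assume x: "1 < norm x" "1 / \<epsilon> \<le> norm x" and y: "y \<noteq> 0" and P: "?P x y"
    have "mon x y q \<le> mon x y v" using P q by blast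
    then have "norm x ^ fst q \<le> norm x ^ fst v" using y True by (simp add: mon_def)
    then have "fst q \<le> fst v" using x by (simp add: power_increasing_iff)
    moreover have "fst q \<noteq> fst v" using True \<open>q \<noteq> v\<close> by (simp add: prod_eq_iff)
    ultimately have "Suc (fst q) \<le> fst v" by simp
    then have "norm x ^ Suc (fst q) \<le> norm x ^ fst v" using x by (intro power_increasing) auto
    then have "\<epsilon> * (norm x ^ Suc (fst q) * norm y ^ snd v) \<le> \<epsilon> * mon x y v"
      using \<epsilon> unfolding mon_def by (intro mult_left_mono mult_right_mono) auto
    also have "\<dots> < mon x y q" using P by blast
    finally have "(\<epsilon> * norm x) * mon x y q < 1 * mon x y q"
      using True by (simp add: mon_def ac_simps)
    then have "\<epsilon> * norm x < 1" by (subst (asm) mult_less_cancel_right) (auto simp: mon_def)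
    then show False using x(2) \<epsilon> by (simp add: field_simps)
  qed
next
  case False
  define \<theta> where "\<theta> = (real (fst v) - real (fst q)) / (real (snd q) - real (snd v))"
  have eq: "weight \<theta> q = weight \<theta> v" using False by (simp add: \<theta>_def weight_def field_simps)
  have annulus: "\<epsilon> * norm x powr \<theta> \<le> norm y \<and> norm y \<le> norm x powr \<theta> / \<epsilon>"
    if x: "1 < norm x" and y: "y \<noteq> 0" and P: "?P x y" for x y
  proof -
    define s where "s = norm y / norm x powr \<theta>"
    have x0: "0 < norm x" using x by linarith
    have s0: "0 < s" using x0 y by (simp add: s_def)
    have s: "norm y = norm x powr \<theta> * s" using x0 by (simp add: s_def)
    have mon: "mon x y r = norm x powr weight \<theta> r * s ^ snd r" for r
      by (rule mon_powr[OF x0 s])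
    have "mon x y q \<le> mon x y v" "\<epsilon> * mon x y v < mon x y q" using P q by blast+
    then have le: "s ^ snd q \<le> s ^ snd v" and ge: "\<epsilon> * s ^ snd v < s ^ snd q"
      unfolding mon eq using x0 by (simp_all add: mult.left_commute[of \<epsilon>])
    have key: "\<epsilon> \<le> s \<and> s \<le> 1 / \<epsilon>"
      if mn: "m < n" and "s ^ n \<le> s ^ m / \<epsilon>" "\<epsilon> * s ^ m \<le> s ^ n" for m n
    proof -
      obtain j where n: "n = m + Suc j" using mn less_imp_Suc_add by auto
      have "s ^ Suc j \<le> 1 / \<epsilon>" "\<epsilon> \<le> s ^ Suc j"
        using that(2,3) s0 \<epsilon> unfolding n power_add by (simp_all add: field_simps)
      show ?thesis
      proof (cases "s \<le> 1")
        case True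
        then have "s ^ Suc j \<le> s" using s0 power_decreasing[of 1 "Suc j" s] by simp
        then show ?thesis using \<open>\<epsilon> \<le> s ^ Suc j\<close> True \<epsilon> by (simp add: le_divide_eq mult_le_one)
      next
        case False
        then have "s \<le> s ^ Suc j" using self_le_power[of s "Suc j"] by simp
        then show ?thesis using \<open>s ^ Suc j \<le> 1 / \<epsilon>\<close> False \<epsilon> by linarith
      qed
    qed
    have "s ^ snd v \<le> s ^ snd v / \<epsilon>" "\<epsilon> * s ^ snd q \<le> s ^ snd q"
      using s0 \<epsilon> by (simp_all add: le_divide_eq mult_left_le mult_le_cancel_right1)
    then have "s ^ snd q \<le> s ^ snd v / \<epsilon>" "\<epsilon> * s ^ snd q \<le> s ^ snd v" "s ^ snd v \<le> s ^ snd q / \<epsilon>"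
      using le ge \<epsilon> by (auto simp: field_simps)
    then have "\<epsilon> \<le> s \<and> s \<le> 1 / \<epsilon>"
      using key[of "snd q" "snd v"] key[of "snd v" "snd q"] ge False by (cases "snd q < snd v") auto
    then show ?thesis using x0 s0 \<epsilon> by (simp add: s_def field_simps)
  qed
  consider "1 < \<theta>" | "\<theta> \<le> 1" "v \<in> face (support k) \<theta>" | "v \<notin> face (support k) \<theta>" by linarith
  then show ?thesis
  proof cases
    case 1
    then obtain R where R: "\<And>t. R \<le> t \<Longrightarrow> 1 / \<epsilon> < t powr (\<theta> - 1)"
      using eventually_powr_greater[of "\<theta> - 1" "1 / \<epsilon>"] by auto
    show ?thesis
    proof (rule good_vacuous[of R])
      fix x y :: complex
      assume x: "1 < norm x" "R \<le> norm x" and y: "y \<noteq> 0" "norm y \<le> norm x" and P: "?P x y"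
      have "\<epsilon> * norm x powr \<theta> \<le> norm x" using annulus[OF x(1) y(1) P] y(2) by linarith
      moreover have "norm x powr \<theta> = norm x powr (\<theta> - 1) * norm x" using x by (simp add: powr_diff)
      ultimately have "\<epsilon> * norm x powr (\<theta> - 1) * norm x \<le> 1 * norm x" by simp
      then have "\<epsilon> * norm x powr (\<theta> - 1) \<le> 1"
        using x(1) by (subst (asm) mult_le_cancel_right) auto
      then show False using R[OF x(2)] \<epsilon> by (simp add: field_simps)
    qed
  next
    case 2
    have "q \<in> face (support k) \<theta>" using 2(2) q eq by (simp add: face_def)
    then have "good (\<lambda>x y. \<epsilon> * norm x powr \<theta> \<le> norm y \<and> norm y \<le> norm x powr \<theta> / \<epsilon>)"
      using good_annulus[OF 2] False \<epsilon>(1) by auto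
    then show ?thesis by (rule good_mono[of _ 1]) (rule annulus)
  next
    case 3
    then obtain p where p: "p \<in> support k" "weight \<theta> v < weight \<theta> p"
      using v by (auto simp: face_def not_le)
    define M where "M = (1 / \<epsilon>) ^ snd v / \<epsilon> ^ snd p"
    obtain R where R: "\<And>t. R \<le> t \<Longrightarrow> M < t powr (weight \<theta> p - weight \<theta> v)"
      using eventually_powr_greater[of "weight \<theta> p - weight \<theta> v" M] p(2) by auto
    show ?thesis
    proof (rule good_vacuous[of R])
      fix x y :: complex
      assume x: "1 < norm x" "R \<le> norm x" and y: "y \<noteq> 0" and P: "?P x y"
      define s where "s = norm y / norm x powr \<theta>"
      have s: "norm y = norm x powr \<theta> * s" using x by (cases "x = 0") (auto simp: s_def)
      have x0: "0 < norm x" using x by linarith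
      have mon: "mon x y r = norm x powr weight \<theta> r * s ^ snd r" for r
        by (rule mon_powr[OF x0 s])
      have s\<epsilon>: "\<epsilon> \<le> s" "s \<le> 1 / \<epsilon>"
        using annulus[OF x(1) y P] x0 \<epsilon> by (simp_all add: s_def field_simps)
      have "norm x powr weight \<theta> p * \<epsilon> ^ snd p \<le> norm x powr weight \<theta> p * s ^ snd p"
        using s\<epsilon> \<epsilon> by (intro mult_left_mono power_mono) auto
      also have "\<dots> \<le> norm x powr weight \<theta> v * s ^ snd v" using P p(1) by (auto simp flip: mon)
      also have "\<dots> \<le> norm x powr weight \<theta> v * (1 / \<epsilon>) ^ snd v"
        using s\<epsilon> \<epsilon> by (intro mult_left_mono power_mono) auto
      finally have "norm x powr weight \<theta> p / norm x powr weight \<theta> v \<le> M"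
        using x0 \<epsilon> by (simp add: M_def field_simps)
      then show False using R[OF x(2)] by (simp add: powr_diff)
    qed
  qed
qed

lemma good_everywhere: "good (\<lambda>x y. True)"
proof -
  let ?A = "support k"
  have "\<exists>E. \<forall>v\<in>?A. 0 < E v \<and> good (\<lambda>x y. (\<forall>q\<in>?A. mon x y q \<le> mon x y v) \<and>
      (\<forall>q\<in>?A - {v}. mon x y q \<le> E v * mon x y v))"
    by (intro bchoice ballI good_vertex)
  then obtain E where E: "\<forall>v\<in>?A. 0 < E v \<and> good (\<lambda>x y. (\<forall>q\<in>?A. mon x y q \<le> mon x y v) \<and>
      (\<forall>q\<in>?A - {v}. mon x y q \<le> E v * mon x y v))" ..
  define \<epsilon> where "\<epsilon> = Min (insert 1 (E ` ?A))"
  have \<epsilon>: "0 < \<epsilon>" "\<epsilon> \<le> 1" "\<And>v. v \<in> ?A \<Longrightarrow> \<epsilon> \<le> E v"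
    using finite_support E unfolding \<epsilon>_def by auto
  let ?V = "\<lambda>v x y. (\<forall>q\<in>?A. mon x y q \<le> mon x y v) \<and> (\<forall>q\<in>?A - {v}. mon x y q \<le> E v * mon x y v)"
  let ?Q = "\<lambda>z x y. (\<forall>p\<in>?A. mon x y p \<le> mon x y (fst z)) \<and> \<epsilon> * mon x y (fst z) < mon x y (snd z)"
  have "good (\<lambda>x y. \<exists>v\<in>?A. ?V v x y)"
    using finite_support E by (intro good_finite_disj) auto
  moreover have "good (\<lambda>x y. \<exists>z\<in>{z \<in> ?A \<times> ?A. snd z \<noteq> fst z}. ?Q z x y)"
    using finite_support \<epsilon> by (intro good_finite_disj good_comparable_pair) auto
  ultimately have "good (\<lambda>x y. (\<exists>v\<in>?A. ?V v x y) \<or> (\<exists>z\<in>{z \<in> ?A \<times> ?A. snd z \<noteq> fst z}. ?Q z x y))"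
    by (rule good_disj)
  then show ?thesis
  proof (rule good_mono[of _ 1])
    fix x y :: complex
    have "?A \<noteq> {}" using low_row by blast
    then obtain v where v: "v \<in> ?A" "\<forall>q\<in>?A. mon x y q \<le> mon x y v"
      using finite_support Max_in[of "mon x y ` ?A"] Max_ge[of "mon x y ` ?A"] by fastforce
    show "(\<exists>v\<in>?A. ?V v x y) \<or> (\<exists>z\<in>{z \<in> ?A \<times> ?A. snd z \<noteq> fst z}. ?Q z x y)"
    proof (cases "\<exists>q\<in>?A - {v}. \<epsilon> * mon x y v < mon x y q")
      case True
      then obtain q where "q \<in> ?A - {v}" "\<epsilon> * mon x y v < mon x y q" by blast
      then have "\<exists>z\<in>{z \<in> ?A \<times> ?A. snd z \<noteq> fst z}. ?Q z x y" using v by (intro bexI[of _ "(v, q)"]) auto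
      then show ?thesis ..
    next
      case False
      have "mon x y q \<le> E v * mon x y v" if "q \<in> ?A - {v}" for q
      proof -
        have "mon x y q \<le> \<epsilon> * mon x y v" using False that by (meson not_less)
        also have "\<dots> \<le> E v * mon x y v" using \<epsilon>(3)[OF v(1)] by (intro mult_right_mono) (auto simp: mon_def)
        finally show ?thesis .
      qed
      then show ?thesis using v by blast
    qed
  qed
qed

lemma gradient_lower_bound:
  "\<exists>c>0. \<exists>R. \<forall>x y. R \<le> norm x \<longrightarrow> norm y \<le> norm x \<longrightarrow>
     c * norm x powr l \<le> max (norm (partial_X k x y)) (norm (partial_Y k x y))"
proof -
  obtain c R where "c > 0" and c: "\<And>x y. \<lbrakk>R \<le> norm x; y \<noteq> 0; norm y \<le> norm x\<rbrakk> \<Longrightarrow>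
     c * norm x powr l \<le> max (norm (partial_X k x y)) (norm (partial_Y k x y))"
    using good_everywhere unfolding good_def by blast
  have "c * norm x powr l \<le> max (norm (partial_X k x y)) (norm (partial_Y k x y))"
    if x: "max 1 R \<le> norm x" and y: "norm y \<le> norm x" for x y
  proof (cases "y = 0")
    case True
    have "isCont (\<lambda>y. max (norm (partial_X k x y)) (norm (partial_Y k x y))) 0"
      unfolding partial_X_def partial_Y_def by (intro continuous_intros)
    then have "((\<lambda>y. max (norm (partial_X k x y)) (norm (partial_Y k x y))) \<longlongrightarrow>
        max (norm (partial_X k x 0)) (norm (partial_Y k x 0))) (at 0)"
      by (simp add: isCont_def)
    moreover have "eventually (\<lambda>y. c * norm x powr l \<le>
        max (norm (partial_X k x y)) (norm (partial_Y k x y))) (at 0)"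
      unfolding eventually_at using x by (intro exI[of _ 1]) (auto intro!: c)
    ultimately show ?thesis using True by (auto intro: tendsto_lowerbound)
  qed (use c x y in auto)
  then show ?thesis using \<open>c > 0\<close> by blast
qed

end

section \<open>The upper bound for the exponent\<close>

text \<open>
  Up to the factor \<open>p(0)\<close> the coefficients are the elementary symmetric functions of the reciprocals of
  the roots, which are at most \<open>1 / M\<close> in norm; the power of \<open>2\<close> bounds the binomial coefficients.
\<close>

lemma coeff_le_of_large_roots:
  fixes p :: "complex poly"
  assumes "0 < M" and "\<And>z. poly p z = 0 \<Longrightarrow> M \<le> norm z"
  shows "norm (coeff p j) * M ^ j \<le> 2 ^ degree p * norm (coeff p 0)"
  using assms(2)
proof (induction "degree p" arbitrary: p j)
  case 0
  then obtain c where "p = [:c:]" by (metis degree_eq_zeroE)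
  then show ?case by (cases j) auto
next
  case (Suc n)
  have "\<not> constant (poly p)" using Suc.hyps(2) by (simp add: constant_degree)
  then obtain z where z: "poly p z = 0" using fundamental_theorem_of_algebra by blast
  then obtain q where q: "p = [:- z, 1:] * q" by (metis dvd_def poly_eq_0_iff_dvd)
  have "p \<noteq> 0" using Suc.hyps(2) by auto
  then have "q \<noteq> 0" using q by auto
  then have "degree p = Suc (degree q)" unfolding q by (subst degree_mult_eq) auto
  then have n: "n = degree q" using Suc.hyps(2) by simp
  have Mz: "M \<le> norm z" using Suc.prems z by blast
  have IH: "norm (coeff q i) * M ^ i \<le> 2 ^ n * norm (coeff q 0)" for i
    using Suc.hyps(1)[OF n, of i] Suc.prems n unfolding q by (metis mult_eq_0_iff poly_mult)
  have c0: "norm (coeff p 0) = norm z * norm (coeff q 0)" by (simp add: q norm_mult)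
  have "norm (coeff p j) * M ^ j \<le> 2 * (2 ^ n * (norm z * norm (coeff q 0)))"
  proof (cases j)
    case 0
    have "1 * (norm z * norm (coeff q 0)) \<le> 2 ^ Suc n * (norm z * norm (coeff q 0))"
      by (intro mult_right_mono one_le_power) auto
    then show ?thesis using 0 c0 by simp
  next
    case (Suc i)
    have "norm (coeff p j) \<le> norm z * norm (coeff q j) + norm (coeff q i)"
      using norm_triangle_ineq[of "- z * coeff q j" "coeff q i"]
      by (simp add: q Suc norm_mult)
    then have "norm (coeff p j) * M ^ j \<le>
        (norm z * norm (coeff q j) + norm (coeff q i)) * M ^ j"
      using assms(1) by (intro mult_right_mono) auto
    also have "\<dots> = norm z * (norm (coeff q j) * M ^ j) + M * (norm (coeff q i) * M ^ i)"
      by (simp add: Suc algebra_simps)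
    also have "\<dots> \<le> norm z * (2 ^ n * norm (coeff q 0)) + norm z * (2 ^ n * norm (coeff q 0))"
      using assms(1) by (intro add_mono mult_mono IH Mz) auto
    finally show ?thesis by (simp add: ac_simps)
  qed
  then show ?case unfolding c0 Suc.hyps(2)[symmetric] by simp
qed

text \<open>
  The gradient is tested at zeros of \<open>\<partial>h/\<partial>Y\<close> with \<open>x = t\<close> large and \<open>|y| \<le> M t\<^bsup>\<theta>\<^esup>\<close>.
\<close>

lemma exponent_le_intercept:
  assumes fin: "finite (support k)" and d: "d \<in> intercepts (support k)" and "0 < c"
    and lower: "\<And>x y. R \<le> max (norm x) (norm y) \<Longrightarrow>
      c * max (norm x) (norm y) powr l \<le> max (norm (partial_X k x y)) (norm (partial_Y k x y))"
  shows "l \<le> d - 1"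
proof (rule ccontr)
  assume contra: "\<not> l \<le> d - 1"
  let ?A = "support k"
  obtain \<theta> v where v: "v \<in> face ?A \<theta>" "2 \<le> snd v" "d = weight \<theta> v"
    using d unfolding intercepts_def by blast
  have vA: "v \<in> ?A" "k v \<noteq> 0" using face_subset[OF v(1)] by (auto simp: support_def)
  have le_d: "weight \<theta> q \<le> d" if "q \<in> ?A" for q using v that by (auto simp: face_def)
  define n where "n = snd v"
  have n: "2 \<le> n" using v(2) by (simp add: n_def)
  define N where "N = Max (snd ` ?A)"
  have N: "snd q \<le> N" if "q \<in> ?A" for q unfolding N_def using fin that by simp
  define C where "C = (\<Sum>q\<in>?A. real (snd q) * norm (k q))"
  define \<delta> where "\<delta> = norm (of_nat n * k v) / 2"
  have C0: "0 \<le> C" unfolding C_def by (intro sum_nonneg) auto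
  have "0 < \<delta>" using vA n by (simp add: \<delta>_def norm_mult)
  \<comment> \<open>Large enough to contradict \<open>coeff_le_of_large_roots\<close> for the coefficients \<open>0\<close> and \<open>n - 1 \<ge> 1\<close>.\<close>
  define M where "M = 2 ^ N * C / \<delta> + 1"
  have M: "1 \<le> M" using C0 \<open>0 < \<delta>\<close> by (simp add: M_def)
  define f where "f t q = of_nat (snd q) * k q * of_real (t powr (weight \<theta> q - d))" for t :: real and q
  \<comment> \<open>Up to the factor \<open>t\<^bsup>d-\<theta>\<^esup>\<close> this is \<open>\<partial>h/\<partial>Y\<close> at \<open>(t, t\<^bsup>\<theta>\<^esup> w)\<close> as a polynomial in \<open>w\<close>.\<close>
  define P where "P t = (\<Sum>q\<in>?A. monom (f t q) (snd q - 1))" for t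
  have eval: "partial_Y k (of_real t) (of_real (t powr \<theta>) * w) = of_real (t powr (d - \<theta>)) * poly (P t) w"
    if "1 \<le> t" for t w
    unfolding partial_Y_def P_def poly_sum poly_monom sum_distrib_left
  proof (rule sum.cong[OF refl])
    fix q
    show "of_nat (snd q) * k q * of_real t ^ fst q * (of_real (t powr \<theta>) * w) ^ (snd q - 1) =
        of_real (t powr (d - \<theta>)) * (f t q * w ^ (snd q - 1))"
    proof (cases "snd q")
      case (Suc j)
      have "t ^ fst q * (t powr \<theta>) ^ j = t powr (real (fst q) + \<theta> * real j)"
        using that by (simp add: powr_add powr_realpow powr_powr[symmetric])
      also have "real (fst q) + \<theta> * real j = (d - \<theta>) + (weight \<theta> q - d)"
        by (simp add: weight_def Suc algebra_simps)
      also have "t powr ((d - \<theta>) + (weight \<theta> q - d)) = t powr (d - \<theta>) * t powr (weight \<theta> q - d)"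
        by (rule powr_add)
      finally have "t ^ fst q * (t powr \<theta>) ^ j = t powr (d - \<theta>) * t powr (weight \<theta> q - d)" .
      then have "(of_real t :: complex) ^ fst q * of_real (t powr \<theta>) ^ j =
          of_real (t powr (d - \<theta>)) * of_real (t powr (weight \<theta> q - d))"
        by (metis of_real_mult of_real_power)
      then show ?thesis by (simp add: f_def Suc power_mult_distrib)
    qed (simp add: f_def)
  qed
  have coeff0: "norm (coeff (P t) 0) \<le> C" if "1 \<le> t" for t
    unfolding P_def coeff_sum C_def
  proof (rule sum_norm_le)
    fix q assume "q \<in> ?A"
    then have "t powr (weight \<theta> q - d) \<le> t powr 0" using le_d that by (intro powr_mono) auto
    then have "real (snd q) * norm (k q) * t powr (weight \<theta> q - d) \<le> real (snd q) * norm (k q) * 1"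
      using that by (intro mult_left_mono) auto
    then show "norm (coeff (monom (f t q) (snd q - 1)) 0) \<le> real (snd q) * norm (k q)"
      by (simp add: coeff_monom f_def norm_mult)
  qed
  have "((\<lambda>t. coeff (P t) (n - 1)) \<longlongrightarrow> (\<Sum>q\<in>?A. if q = v then of_nat n * k v else 0)) at_top"
    unfolding P_def coeff_sum
  proof (rule tendsto_sum)
    fix q assume q: "q \<in> ?A"
    consider "q = v" | "q \<noteq> v" "snd q = n" | "snd q \<noteq> n" by blast
    then show "((\<lambda>t. coeff (monom (f t q) (snd q - 1)) (n - 1)) \<longlongrightarrow>
        (if q = v then of_nat n * k v else 0)) at_top"
    proof cases
      case 1
      have "eventually (\<lambda>t. coeff (monom (f t q) (snd q - 1)) (n - 1) = of_nat n * k v) at_top"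
        using eventually_gt_at_top[of "0::real"] by eventually_elim (simp add: f_def 1 v(3) n_def)
      then show ?thesis using 1 by (simp add: tendsto_eventually)
    next
      case 2
      have "weight \<theta> q \<noteq> d" using 2 v(3) by (auto simp: weight_def n_def prod_eq_iff)
      then have "((\<lambda>t. t powr (weight \<theta> q - d)) \<longlongrightarrow> 0) at_top"
        using le_d[OF q] by (intro tendsto_neg_powr filterlim_ident) auto
      then have "((\<lambda>t. of_nat (snd q) * k q * complex_of_real (t powr (weight \<theta> q - d))) \<longlongrightarrow>
          of_nat (snd q) * k q * complex_of_real 0) at_top"
        by (intro tendsto_intros)
      then show ?thesis using 2 by (simp add: f_def)
    next
      case 3
      then have "snd q - 1 \<noteq> n - 1" using n by auto
      then show ?thesis using 3 by (auto simp: n_def)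
    qed
  qed
  then have "((\<lambda>t. coeff (P t) (n - 1)) \<longlongrightarrow> of_nat n * k v) at_top"
    using vA fin by simp
  then have "((\<lambda>t. norm (coeff (P t) (n - 1))) \<longlongrightarrow> norm (of_nat n * k v)) at_top"
    by (rule tendsto_norm)
  moreover have "\<delta> < norm (of_nat n * k v)" using \<open>0 < \<delta>\<close> by (simp add: \<delta>_def)
  ultimately have "eventually (\<lambda>t. \<delta> < norm (coeff (P t) (n - 1))) at_top"
    by (rule order_tendstoD)
  then obtain R1 where R1: "\<And>t. R1 \<le> t \<Longrightarrow> \<delta> < norm (coeff (P t) (n - 1))"
    by (auto simp: eventually_at_top_linorder)
  have root: "\<exists>w. poly (P t) w = 0 \<and> norm w \<le> M" if t: "1 \<le> t" "R1 \<le> t" for t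
  proof (rule ccontr)
    assume "\<nexists>w. poly (P t) w = 0 \<and> norm w \<le> M"
    then have "norm (coeff (P t) (n - 1)) * M ^ (n - 1) \<le> 2 ^ degree (P t) * norm (coeff (P t) 0)"
      using M by (intro coeff_le_of_large_roots) (auto simp: not_le less_imp_le)
    also have "\<dots> \<le> 2 ^ N * C"
    proof (intro mult_mono power_increasing coeff0 t)
      show "degree (P t) \<le> N" unfolding P_def
      proof (rule degree_sum_le[OF fin])
        fix q assume "q \<in> ?A"
        then show "degree (monom (f t q) (snd q - 1)) \<le> N"
          using N[of q] degree_monom_le[of "f t q" "snd q - 1"] by linarith
      qed
    qed auto
    also have "\<dots> < \<delta> * M" using \<open>0 < \<delta>\<close> by (simp add: M_def field_simps)
    also have "\<delta> * M \<le> norm (coeff (P t) (n - 1)) * M ^ (n - 1)"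
      using R1[OF t(2)] M n \<open>0 < \<delta>\<close> by (intro mult_mono self_le_power) auto
    finally show False by simp
  qed
  define D where "D = (\<Sum>q\<in>?A. real (fst q) * norm (k q) * M ^ snd q)"
  have D0: "0 \<le> D" unfolding D_def using M by (intro sum_nonneg) auto
  have X_le: "norm (partial_X k (of_real t) y) \<le> D * t powr (d - 1)"
    if t: "1 \<le> t" and y: "norm y \<le> t powr \<theta> * M" for t y
  proof -
    have "norm (of_real t * partial_X k (of_real t) y) \<le> D * t powr d"
      unfolding euler_X D_def sum_distrib_right
    proof (rule sum_norm_le)
      fix q assume q: "q \<in> ?A"
      have "t ^ fst q * norm y ^ snd q \<le> t ^ fst q * (t powr \<theta> * M) ^ snd q"
        using t y by (intro mult_left_mono power_mono) auto
      also have "\<dots> = M ^ snd q * t powr weight \<theta> q"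
        using t by (simp add: weight_def powr_add powr_realpow powr_powr[symmetric] power_mult_distrib)
      also have "\<dots> \<le> M ^ snd q * t powr d"
        using t M le_d[OF q] by (intro mult_left_mono powr_mono) auto
      finally have "real (fst q) * norm (k q) * (t ^ fst q * norm y ^ snd q) \<le>
          real (fst q) * norm (k q) * (M ^ snd q * t powr d)" by (intro mult_left_mono) auto
      then show "norm (of_nat (fst q) * k q * (of_real t ^ fst q * y ^ snd q)) \<le>
          real (fst q) * norm (k q) * M ^ snd q * t powr d"
        using t by (simp add: norm_mult norm_power ac_simps)
    qed
    also have "t powr d = t powr (d - 1) * t" using t by (simp add: powr_diff)
    finally have "norm (partial_X k (of_real t) y) * t \<le> D * t powr (d - 1) * t"
      using t by (simp add: norm_mult ac_simps)
    then show ?thesis using t by (subst (asm) mult_le_cancel_right) auto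
  qed
  \<comment> \<open>A bound for \<open>t\<^bsup>d-1\<^esup>\<close> in terms of \<open>max |x| |y|\<close>: if \<open>d \<ge> 1\<close>, then
    \<open>t \<le> max |x| |y|\<close> suffices; otherwise \<open>\<theta> \<le> 1\<close> and so \<open>max |x| |y| \<le> M t\<close>.\<close>
  define L where "L = max 1 (M powr (1 - d))"
  obtain R2 where R2: "\<And>t. R2 \<le> t \<Longrightarrow> D * L / c < t powr (l - (d - 1))"
    using eventually_powr_greater[of "l - (d - 1)" "D * L / c"] contra by auto
  define t where "t = Max {1, R, R1, R2}"
  have t: "1 \<le> t" "R \<le> t" "R1 \<le> t" "R2 \<le> t" by (auto simp: t_def)
  obtain w where w: "poly (P t) w = 0" "norm w \<le> M" using root[OF t(1,3)] by blast
  define y where "y = of_real (t powr \<theta>) * w"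
  define m where "m = max t (norm y)"
  have y: "norm y \<le> t powr \<theta> * M" using w(2) t by (simp add: y_def norm_mult mult_left_mono)
  have m: "t \<le> m" by (simp add: m_def)
  have "partial_Y k (of_real t) y = 0" using eval[OF t(1), of w] w(1) by (simp add: y_def)
  then have "c * m powr l \<le> norm (partial_X k (of_real t) y)"
    using lower[of "of_real t" y] t by (simp add: m_def)
  also have "\<dots> \<le> D * t powr (d - 1)" by (rule X_le[OF t(1) y])
  also have "\<dots> \<le> D * (L * m powr (d - 1))"
  proof (rule mult_left_mono[OF _ D0])
    show "t powr (d - 1) \<le> L * m powr (d - 1)"
    proof (cases "1 \<le> d")
      case True
      have "t powr (d - 1) \<le> 1 * m powr (d - 1)" using True t m by (simp add: powr_mono2)
      also have "\<dots> \<le> L * m powr (d - 1)" by (intro mult_right_mono) (auto simp: L_def)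
      finally show ?thesis .
    next
      case False
      have "\<theta> \<le> 1"
      proof (rule ccontr)
        assume "\<not> \<theta> \<le> 1"
        then have "1 * 2 \<le> \<theta> * real (snd v)" using v(2) by (intro mult_mono) auto
        then show False using False v(3) by (simp add: weight_def)
      qed
      then have "t powr \<theta> \<le> t" using powr_mono[of \<theta> 1 t] t by simp
      then have "t powr \<theta> * M \<le> t * M" using M by (intro mult_right_mono) auto
      moreover have "t \<le> t * M" using t M by simp
      ultimately have "m \<le> t * M" using y unfolding m_def by (intro max.boundedI) linarith+
      then have "m / M \<le> t" using M by (simp add: divide_le_eq)
      then have "t powr (d - 1) \<le> (m / M) powr (d - 1)"
        using False t m M by (intro powr_mono2') auto
      also have "\<dots> = M powr (1 - d) * m powr (d - 1)"
        using t m M by (simp add: powr_divide powr_diff field_simps)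
      also have "\<dots> \<le> L * m powr (d - 1)" by (intro mult_right_mono) (auto simp: L_def)
      finally show ?thesis .
    qed
  qed
  finally have "c * m powr l \<le> D * L * m powr (d - 1)" by simp
  moreover have "D * L < c * m powr (l - (d - 1))"
    using R2[of m] t m \<open>0 < c\<close> by (simp add: divide_less_eq mult.commute)
  then have "D * L * m powr (d - 1) < c * m powr (l - (d - 1)) * m powr (d - 1)"
    using t m by (intro mult_strict_right_mono) auto
  moreover have "m powr (l - (d - 1)) * m powr (d - 1) = m powr l" by (simp flip: powr_add)
  ultimately show False by (simp add: mult.assoc)
qed

section \<open>Segments of the Newton polygon at infinity\<close>

text \<open>
  The right polygon as a function of the support alone, so that it can be applied to the support with the
  coordinates exchanged.
\<close>

definition right_segments :: "(nat \<times> nat) set \<Rightarrow> (real \<times> real) set set" where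
  "right_segments A =
     {S. aff_dim S = 1 \<and>
         (\<exists>\<theta>. S = max_face (convex hull (real_point ` A)) (\<lambda>(a, b). a + \<theta> * b))}"

abbreviation right_face :: "(nat \<times> nat) set \<Rightarrow> real \<Rightarrow> (real \<times> real) set" where
  "right_face A \<theta> \<equiv> max_face (convex hull (real_point ` A)) (\<lambda>(a, b). a + \<theta> * b)"

lemma inner_real_point: "(1, \<theta>) \<bullet> real_point q = weight \<theta> q"
  by (simp add: weight_def)

text \<open>
  In this form the level sets of the functional are hyperplanes, and its maxima are exposed faces.
\<close>

lemma weight_functional: "(\<lambda>(a, b). a + \<theta> * b) = (\<lambda>p::real \<times> real. (1, \<theta>) \<bullet> p)"
  by (auto simp: inner_prod_def)

lemma hull_halfspace:
  assumes "\<And>q. q \<in> A \<Longrightarrow> weight \<theta> q \<le> d" "p \<in> convex hull (real_point ` A)"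
  shows "(1, \<theta>) \<bullet> p \<le> d"
proof -
  have "(1, \<theta>) \<bullet> real_point q \<le> d" if "q \<in> A" for q
    unfolding inner_real_point using that by (rule assms(1))
  then have "real_point ` A \<subseteq> {p. (1, \<theta>) \<bullet> p \<le> d}" by blast
  then have "convex hull (real_point ` A) \<subseteq> {p. (1, \<theta>) \<bullet> p \<le> d}"
    by (intro hull_minimal convex_halfspace_le)
  then show ?thesis using assms(2) by blast
qed

lemma real_point_in_right_face:
  assumes "q \<in> A"
  shows "real_point q \<in> right_face A \<theta> \<longleftrightarrow> q \<in> face A \<theta>"
proof
  assume "real_point q \<in> right_face A \<theta>"
  then have "\<forall>p\<in>convex hull (real_point ` A). (1, \<theta>) \<bullet> p \<le> (1, \<theta>) \<bullet> real_point q"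
    unfolding max_face_def weight_functional by blast
  then have "weight \<theta> p \<le> weight \<theta> q" if "p \<in> A" for p
    unfolding inner_real_point[symmetric] using that by (blast intro: hull_inc)
  then show "q \<in> face A \<theta>" using assms by (simp add: face_def)
next
  assume "q \<in> face A \<theta>"
  then have "\<forall>p\<in>convex hull (real_point ` A). (1, \<theta>) \<bullet> p \<le> weight \<theta> q"
    using hull_halfspace[of A \<theta> "weight \<theta> q"] by (auto simp: face_def simp del: inner_Pair)
  then show "real_point q \<in> right_face A \<theta>"
    unfolding max_face_def weight_functional mem_Collect_eq inner_real_point
    using hull_inc[of "real_point q" "real_point ` A"] assms by blast
qed

lemma right_face_line:
  assumes "v \<in> face A \<theta>"
  shows "right_face A \<theta> = convex hull (real_point ` A) \<inter> {p. (1, \<theta>) \<bullet> p = weight \<theta> v}"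
proof -
  have v: "real_point v \<in> convex hull (real_point ` A)" using face_subset[OF assms] by (intro hull_inc) auto
  have le: "(1, \<theta>) \<bullet> p \<le> weight \<theta> v" if "p \<in> convex hull (real_point ` A)" for p
    using assms hull_halfspace[OF _ that, of \<theta> "weight \<theta> v"] by (auto simp: face_def)
  show ?thesis
  proof (intro equalityI subsetI)
    fix p assume "p \<in> right_face A \<theta>"
    then have "p \<in> convex hull (real_point ` A)" "(1, \<theta>) \<bullet> real_point v \<le> (1, \<theta>) \<bullet> p"
      using v unfolding max_face_def weight_functional by blast+
    then show "p \<in> convex hull (real_point ` A) \<inter> {p. (1, \<theta>) \<bullet> p = weight \<theta> v}"
      using le[of p] unfolding inner_real_point by auto
  next
    fix p assume "p \<in> convex hull (real_point ` A) \<inter> {p. (1, \<theta>) \<bullet> p = weight \<theta> v}"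
    then show "p \<in> right_face A \<theta>" unfolding max_face_def weight_functional using le by auto
  qed
qed

text \<open>
  A face of a polytope is spanned by vertices of the polytope, and these are points of \<open>A\<close>.
\<close>

lemma right_face_eq_hull:
  assumes "finite A"
  shows "right_face A \<theta> = convex hull (real_point ` face A \<theta>)"
proof (cases "right_face A \<theta> = {}")
  case True
  then have "face A \<theta> = {}"
    using real_point_in_right_face[of _ A \<theta>] face_subset[of _ A \<theta>] by blast
  then show ?thesis unfolding True by simp
next
  case False
  then have "A \<noteq> {}" by (auto simp: max_face_def)
  then obtain v where v: "v \<in> face A \<theta>"
    using Max_in[of "weight \<theta> ` A"] Max_ge[of "weight \<theta> ` A"] assms by (fastforce simp: face_def)
  have "compact (real_point ` A)" using assms by (simp add: finite_imp_compact)
  moreover have "right_face A \<theta> face_of convex hull (real_point ` A)"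
    unfolding right_face_line[OF v]
    using v hull_halfspace[of A \<theta> "weight \<theta> v"]
    by (intro face_of_Int_supporting_hyperplane_le) (auto simp: face_def)
  ultimately obtain B where B: "B \<subseteq> real_point ` A" "right_face A \<theta> = convex hull B"
    by (rule face_of_convex_hull_subset)
  have "B \<subseteq> right_face A \<theta>" unfolding B(2) by (rule hull_subset)
  then have "B \<subseteq> real_point ` face A \<theta>" using B(1) real_point_in_right_face by blast
  then have "right_face A \<theta> \<subseteq> convex hull (real_point ` face A \<theta>)" unfolding B(2) by (rule hull_mono)
  moreover have "convex hull (real_point ` face A \<theta>) \<subseteq> right_face A \<theta>"
  proof (rule hull_minimal)
    show "real_point ` face A \<theta> \<subseteq> right_face A \<theta>"
      using real_point_in_right_face[of _ A \<theta>] face_subset[of _ A \<theta>] by blast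
    show "convex (right_face A \<theta>)" unfolding B(2) by (rule convex_convex_hull)
  qed
  ultimately show ?thesis by (rule equalityI)
qed

lemma face_points_distinct_rows:
  assumes "v \<in> face A \<theta>" "w \<in> face A \<theta>" "v \<noteq> w"
  shows "snd v \<noteq> snd w"
  using face_weight_eq[OF assms(1,2)] assms(3) by (auto simp: weight_def prod_eq_iff)

lemma aff_dim_right_face:
  assumes "finite A"
  shows "aff_dim (right_face A \<theta>) = 1 \<longleftrightarrow> (\<exists>v\<in>face A \<theta>. \<exists>w\<in>face A \<theta>. snd v \<noteq> snd w)"
proof
  assume dim: "aff_dim (right_face A \<theta>) = 1"
  show "\<exists>v\<in>face A \<theta>. \<exists>w\<in>face A \<theta>. snd v \<noteq> snd w"
  proof (rule ccontr)
    assume "\<not> ?thesis"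
    then have "face A \<theta> = {} \<or> (\<exists>v. face A \<theta> = {v})"
      using face_points_distinct_rows[of _ A \<theta>] by blast
    then have "aff_dim (right_face A \<theta>) \<le> 0"
      unfolding right_face_eq_hull[OF assms] by (auto simp: aff_dim_convex_hull)
    then show False using dim by simp
  qed
next
  assume "\<exists>v\<in>face A \<theta>. \<exists>w\<in>face A \<theta>. snd v \<noteq> snd w"
  then obtain v w where vw: "v \<in> face A \<theta>" "w \<in> face A \<theta>" "snd v \<noteq> snd w" by blast
  have "{real_point v, real_point w} \<subseteq> right_face A \<theta>"
    using vw real_point_in_right_face[of _ A \<theta>] face_subset[of _ A \<theta>] by blast
  then have "aff_dim {real_point v, real_point w} \<le> aff_dim (right_face A \<theta>)" by (rule aff_dim_subset)
  moreover have "aff_dim {real_point v, real_point w} = 1" using vw(3) by simp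
  moreover have "aff_dim (right_face A \<theta>) \<le> aff_dim {p :: real \<times> real. (1, \<theta>) \<bullet> p = weight \<theta> v}"
    unfolding right_face_line[OF vw(1)] by (rule aff_dim_subset, rule Int_lower2)
  moreover have "aff_dim {p :: real \<times> real. (1, \<theta>) \<bullet> p = weight \<theta> v} = 1"
    by (subst aff_dim_hyperplane) (auto simp: zero_prod_def)
  ultimately show "aff_dim (right_face A \<theta>) = 1" by simp
qed

lemma alpha_right_face:
  assumes v: "v \<in> face A \<theta>" and w: "w \<in> face A \<theta>" and vw: "snd v \<noteq> snd w"
  shows "alpha (right_face A \<theta>) = weight \<theta> v"
  unfolding alpha_def
proof (rule the_equality)
  let ?t = "real (snd v) / (real (snd v) - real (snd w))"
  have "{real_point v, real_point w} \<subseteq> right_face A \<theta>"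
    using v w real_point_in_right_face[of _ A \<theta>] face_subset[of _ A \<theta>] by blast
  then have "affine hull {real_point v, real_point w} \<subseteq> affine hull right_face A \<theta>" by (rule hull_mono)
  moreover have "(1 - ?t) *\<^sub>R real_point v + ?t *\<^sub>R real_point w \<in> affine hull {real_point v, real_point w}"
    unfolding affine_hull_2 by (intro CollectI exI[of _ "1 - ?t"] exI[of _ ?t]) simp
  moreover have "(1 - ?t) *\<^sub>R real_point v + ?t *\<^sub>R real_point w = (weight \<theta> v, 0)"
  proof -
    let ?D = "real (snd v) - real (snd w)"
    have D: "?t * ?D = real (snd v)" using vw by simp
    have "real (fst w) = real (fst v) + \<theta> * ?D"
      using face_weight_eq[OF v w] by (simp add: weight_def algebra_simps)
    moreover have "(1 - t) * a + t * (a + \<theta> * D) = a + \<theta> * (t * D)" for t a D :: real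
      by (simp add: algebra_simps)
    ultimately have "(1 - ?t) * real (fst v) + ?t * real (fst w) = real (fst v) + \<theta> * (?t * ?D)"
      by metis
    moreover have "(1 - t) * a + t * b = a - t * (a - b)" for t a b :: real
      by (simp add: algebra_simps)
    then have "(1 - ?t) * real (snd v) + ?t * real (snd w) = real (snd v) - ?t * ?D" by metis
    ultimately show ?thesis unfolding D by (simp add: weight_def)
  qed
  ultimately show "(weight \<theta> v, 0) \<in> affine hull right_face A \<theta>" by auto
next
  fix a assume a: "(a, 0) \<in> affine hull right_face A \<theta>"
  have "affine hull right_face A \<theta> \<subseteq> {p. (1, \<theta>) \<bullet> p = weight \<theta> v}"
    unfolding right_face_line[OF v] by (intro hull_minimal affine_hyperplane) auto
  then have "(1, \<theta>) \<bullet> (a, 0) = weight \<theta> v" using a by blast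
  then show "a = weight \<theta> v" by simp
qed

text \<open>
  A face has at most one point in each row, so a segment within the rows \<open>0\<close> and \<open>1\<close> contains just two
  points of \<open>A\<close> and joins them.
\<close>

lemma exceptional_right_face:
  assumes "finite A" and v: "v \<in> face A \<theta>" and w: "w \<in> face A \<theta>" and vw: "snd v \<noteq> snd w"
  shows "exceptional_right (right_face A \<theta>) \<longleftrightarrow> (\<forall>u\<in>face A \<theta>. snd u \<le> 1)"
proof
  assume "exceptional_right (right_face A \<theta>)"
  then obtain a p where S: "right_face A \<theta> = closed_segment (a, 0) (p, 1)"
    unfolding exceptional_right_def by blast
  show "\<forall>u\<in>face A \<theta>. snd u \<le> 1"
  proof
    fix u assume "u \<in> face A \<theta>"
    then have "real_point u \<in> closed_segment (a, 0) (p, 1)"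
      unfolding S[symmetric] using real_point_in_right_face[of u A \<theta>] face_subset[of u A \<theta>] by blast
    then show "snd u \<le> 1" by (auto simp: closed_segment_def)
  qed
next
  assume le: "\<forall>u\<in>face A \<theta>. snd u \<le> 1"
  have *: "exceptional_right (right_face A \<theta>)"
    if "v \<in> face A \<theta>" "w \<in> face A \<theta>" "snd v = 0" "snd w = 1" for v w
  proof -
    have "u = v \<or> u = w" if "u \<in> face A \<theta>" for u
    proof -
      have "snd u = snd v \<or> snd u = snd w" using le that \<open>snd v = 0\<close> \<open>snd w = 1\<close> by fastforce
      then show ?thesis
        using face_points_distinct_rows[OF that] \<open>v \<in> face A \<theta>\<close> \<open>w \<in> face A \<theta>\<close> by blast
    qed
    then have "face A \<theta> = {v, w}" using that by blast
    then have "right_face A \<theta> = closed_segment (real_point v) (real_point w)"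
      by (simp add: right_face_eq_hull[OF assms(1)] segment_convex_hull)
    then show ?thesis unfolding exceptional_right_def using that(3,4) by auto
  qed
  have "snd v \<le> 1" "snd w \<le> 1" using le v w by auto
  then consider "snd v = 0" "snd w = 1" | "snd w = 0" "snd v = 1" using vw by linarith
  then show "exceptional_right (right_face A \<theta>)" using * v w by cases blast+
qed

lemma alpha_image_right_segments:
  assumes "finite A"
  shows "alpha ` {S \<in> right_segments A. \<not> exceptional_right S} = intercepts A"
proof (intro equalityI subsetI)
  fix d assume "d \<in> alpha ` {S \<in> right_segments A. \<not> exceptional_right S}"
  then obtain \<theta> where d: "d = alpha (right_face A \<theta>)" and dim: "aff_dim (right_face A \<theta>) = 1"
    and nonexc: "\<not> exceptional_right (right_face A \<theta>)"
    unfolding right_segments_def by blast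
  obtain v w where vw: "v \<in> face A \<theta>" "w \<in> face A \<theta>" "snd v \<noteq> snd w"
    using dim aff_dim_right_face[OF assms] by blast
  obtain u where u: "u \<in> face A \<theta>" "2 \<le> snd u"
    using nonexc exceptional_right_face[OF assms vw] by fastforce
  show "d \<in> intercepts A" using intercepts_face[OF vw u] alpha_right_face[OF vw] d by simp
next
  fix d assume "d \<in> intercepts A"
  then obtain \<theta> v w where vw: "v \<in> face A \<theta>" "w \<in> face A \<theta>" "snd v \<noteq> snd w" "2 \<le> snd v"
    "d = weight \<theta> v"
    unfolding intercepts_def by blast
  have "right_face A \<theta> \<in> right_segments A"
    unfolding right_segments_def using aff_dim_right_face[OF assms] vw by blast
  moreover have "\<not> exceptional_right (right_face A \<theta>)"
    using exceptional_right_face[OF assms vw(1-3)] vw(1,4) by fastforce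
  ultimately show "d \<in> alpha ` {S \<in> right_segments A. \<not> exceptional_right S}"
    using alpha_right_face[OF vw(1-3)] vw(5) by force
qed

lemma linear_swap: "linear (prod.swap :: real \<times> real \<Rightarrow> real \<times> real)"
  by (intro linearI) auto

lemma swap_image_max_face:
  "prod.swap ` max_face D f = max_face (prod.swap ` D) (f \<circ> prod.swap)"
  unfolding max_face_def by force

lemma swap_image_swap_image [simp]: "prod.swap ` prod.swap ` X = X"
  by (simp add: image_comp)

lemma hull_swap_image:
  "convex hull (real_point ` prod.swap ` A) = prod.swap ` (convex hull (real_point ` A))"
  unfolding convex_hull_linear_image[OF linear_swap] image_comp
  by (rule arg_cong[of _ _ "\<lambda>X. convex hull X"], rule image_cong) auto

text \<open>
  The reflection in the diagonal exchanges the functionals \<open>\<theta> \<alpha> + \<beta>\<close> and \<open>\<alpha> + \<theta> \<beta>\<close>.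
\<close>

lemma top_polygon_eq:
  "top_polygon h = {S. prod.swap ` S \<in> right_segments (prod.swap ` supp h)}"
proof -
  have comp: "(\<lambda>(a, b). a + \<theta> * b) \<circ> prod.swap = (\<lambda>(a, b). \<theta> * a + (b::real))" for \<theta> :: real
    by (auto simp: fun_eq_iff)
  have face: "right_face (prod.swap ` supp h) \<theta> =
      prod.swap ` max_face (newton_diagram h) (\<lambda>(a, b). \<theta> * a + b)" for \<theta>
    unfolding swap_image_max_face hull_swap_image newton_diagram_def
    by (rule arg_cong[of _ _ "max_face _"]) auto
  have "S = max_face (newton_diagram h) f \<longleftrightarrow> prod.swap ` S = prod.swap ` max_face (newton_diagram h) f"
    for S f by (metis swap_image_swap_image)
  then show ?thesis
    unfolding top_polygon_def right_segments_def face
    using aff_dim_injective_linear_image[OF linear_swap inj_swap] by auto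
qed

lemma right_polygon_eq: "right_polygon h = right_segments (supp h)"
  unfolding right_polygon_def right_segments_def newton_diagram_def ..

lemma beta_eq_alpha_swap: "beta S = alpha (prod.swap ` S)"
proof -
  have "affine hull (prod.swap ` S) = prod.swap ` (affine hull S)"
    using affine_hull_linear_image[OF linear_conv_bounded_linear[THEN iffD1, OF linear_swap]] by metis
  moreover have "(a, 0) \<in> prod.swap ` X \<longleftrightarrow> (0, a) \<in> X" for a :: real and X
    by force
  ultimately show ?thesis unfolding alpha_def beta_def by simp
qed

lemma exceptional_top_eq: "exceptional_top S \<longleftrightarrow> exceptional_right (prod.swap ` S)"
proof -
  have "closed_segment (b, 0) (q, 1) = prod.swap ` closed_segment (0, b) (1::real, q)" for b q :: real
    using closed_segment_linear_image[OF linear_swap, of "(0, b)" "(1, q)"] by simp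
  moreover have "X = Y \<longleftrightarrow> prod.swap ` X = prod.swap ` Y" for X Y :: "(real \<times> real) set"
    by (metis swap_image_swap_image)
  ultimately show ?thesis unfolding exceptional_top_def exceptional_right_def by metis
qed

lemma alpha_image_right_polygon:
  assumes "finite (supp h)"
  shows "alpha ` {S \<in> right_polygon h. \<not> exceptional_right S} = intercepts (supp h)"
  using alpha_image_right_segments[OF assms] by (simp add: right_polygon_eq)

lemma beta_image_top_polygon:
  assumes "finite (supp h)"
  shows "beta ` {S \<in> top_polygon h. \<not> exceptional_top S} = intercepts (prod.swap ` supp h)"
proof -
  let ?X = "{S \<in> right_segments (prod.swap ` supp h). \<not> exceptional_right S}"
  have "{S \<in> top_polygon h. \<not> exceptional_top S} = image prod.swap ` ?X"
    unfolding top_polygon_eq exceptional_top_eq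
    by (auto intro!: image_eqI[of _ _ "prod.swap ` _"])
  moreover have "beta ` image prod.swap ` ?X = alpha ` ?X"
    unfolding image_comp comp_def unfolding beta_eq_alpha_swap swap_image_swap_image ..
  ultimately have "beta ` {S \<in> top_polygon h. \<not> exceptional_top S} = alpha ` ?X" by simp
  then show ?thesis using alpha_image_right_segments[of "prod.swap ` supp h"] assms by simp
qed

section \<open>Gradients of polynomials in two variables\<close>

definition coeffs2 :: "bipoly \<Rightarrow> nat \<times> nat \<Rightarrow> complex"
  where "coeffs2 h q = coeff2 h (fst q) (snd q)"

abbreviation monomial_sum :: "(nat \<times> nat) set \<Rightarrow> (nat \<times> nat \<Rightarrow> complex) \<Rightarrow> bipoly" where
  "monomial_sum B k \<equiv> \<Sum>q\<in>B. monom2 (k q) (fst q) (snd q)"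

lemma support_coeffs2: "support (coeffs2 h) = supp h"
  by (auto simp: support_def coeffs2_def supp_def)

lemma finite_supp: "finite (supp h)"
proof -
  have "supp h \<subseteq> (\<Union>b\<in>{..degree h}. {..degree (coeff h b)} \<times> {b})"
  proof
    fix q assume "q \<in> supp h"
    then have q: "coeff (coeff h (snd q)) (fst q) \<noteq> 0" by (auto simp: supp_def coeff2_def)
    then have "fst q \<le> degree (coeff h (snd q))" "snd q \<le> degree h" by (auto intro: le_degree)
    then show "q \<in> (\<Union>b\<in>{..degree h}. {..degree (coeff h b)} \<times> {b})" by (cases q) auto
  qed
  then show ?thesis by (rule finite_subset) auto
qed

lemma coeff2_monom2: "coeff (coeff (monom2 c a b) b') a' = (if (a', b') = (a, b) then c else 0)"
  by (simp add: monom2_def coeff_monom)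

lemma monomial_sum_coeffs2: "monomial_sum (supp h) (coeffs2 h) = h"
proof (intro poly_eqI)
  fix a b
  have "coeff (coeff (monomial_sum (supp h) (coeffs2 h)) b) a =
      (\<Sum>q\<in>supp h. if (a, b) = q then coeffs2 h q else 0)"
    by (simp add: coeff_sum coeff2_monom2)
  also have "\<dots> = coeff (coeff h b) a"
    using finite_supp by (simp add: sum.delta') (simp add: coeffs2_def supp_def coeff2_def)
  finally show "coeff (coeff (monomial_sum (supp h) (coeffs2 h)) b) a = coeff (coeff h b) a" .
qed

lemma eval2_sum: "eval2 (sum f B) z = (\<Sum>q\<in>B. eval2 (f q) z)"
  by (simp add: eval2_def poly_sum)

lemma eval2_monom2: "eval2 (monom2 c a b) (x, y) = c * x ^ a * y ^ b"
  by (simp add: eval2_def monom2_def poly_monom poly_power)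

lemma pderiv_X_sum: "pderiv_X (sum f B) = (\<Sum>q\<in>B. pderiv_X (f q))"
proof -
  have "pderiv_X (f + g) = pderiv_X f + pderiv_X g" for f g
    unfolding pderiv_X_def by (intro poly_eqI) (simp add: coeff_map_poly pderiv_add)
  moreover have "pderiv_X 0 = 0" by (simp add: pderiv_X_def)
  ultimately show ?thesis by (induction B rule: infinite_finite_induct) auto
qed

lemma pderiv_Y_sum: "pderiv_Y (sum f B) = (\<Sum>q\<in>B. pderiv_Y (f q))"
  unfolding pderiv_Y_def by (induction B rule: infinite_finite_induct) (auto simp: pderiv_add)

lemma pderiv_X_monom2: "pderiv_X (monom2 c a b) = monom2 (of_nat a * c) (a - 1) b"
  by (simp add: pderiv_X_def monom2_def map_poly_monom pderiv_monom)

lemma pderiv_Y_monom2: "pderiv_Y (monom2 c a b) = monom2 (of_nat b * c) a (b - 1)"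
  by (simp add: pderiv_Y_def monom2_def pderiv_monom of_nat_poly smult_monom flip: monom_0)
     (simp add: monom_0 smult_monom)

lemma eval_pderiv_X_monomial_sum:
  "eval2 (pderiv_X (monomial_sum B k)) (x, y) =
     (\<Sum>q\<in>B. of_nat (fst q) * k q * x ^ (fst q - 1) * y ^ snd q)"
  by (simp add: pderiv_X_sum eval2_sum pderiv_X_monom2 eval2_monom2)

lemma eval_pderiv_Y_monomial_sum:
  "eval2 (pderiv_Y (monomial_sum B k)) (x, y) =
     (\<Sum>q\<in>B. of_nat (snd q) * k q * x ^ fst q * y ^ (snd q - 1))"
  by (simp add: pderiv_Y_sum eval2_sum pderiv_Y_monom2 eval2_monom2)

lemma eval_pderiv:
  "eval2 (pderiv_X h) (x, y) = partial_X (coeffs2 h) x y"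
  "eval2 (pderiv_Y h) (x, y) = partial_Y (coeffs2 h) x y"
  using eval_pderiv_X_monomial_sum[of "coeffs2 h" "supp h" x y]
    eval_pderiv_Y_monomial_sum[of "coeffs2 h" "supp h" x y]
  unfolding monomial_sum_coeffs2 partial_X_def partial_Y_def support_coeffs2 by simp_all

lemma max_norm_grad:
  "max_norm (eval_map (grad h) (x, y)) =
     max (norm (partial_X (coeffs2 h) x y)) (norm (partial_Y (coeffs2 h) x y))"
  by (simp add: max_norm_def eval_map_def grad_def eval_pderiv)

lemma support_swap: "support (k \<circ> prod.swap) = prod.swap ` support k"
  by (force simp: support_def)

lemma partial_swap:
  "partial_X (k \<circ> prod.swap) x y = partial_Y k y x"
  "partial_Y (k \<circ> prod.swap) x y = partial_X k y x"
  unfolding partial_X_def partial_Y_def support_swap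
  by (subst sum.reindex; simp add: ac_simps)+

lemma exists_low_row:
  assumes "\<not> var_Y ^ 2 dvd h"
  shows "\<exists>q\<in>supp h. snd q \<le> 1"
proof (rule ccontr)
  assume none: "\<not> ?thesis"
  have "coeff h b = 0" if "b < 2" for b
    using none that by (intro poly_eqI) (force simp: supp_def coeff2_def)
  then have "monom 1 2 dvd h" by (simp add: monom_1_dvd_iff')
  moreover have "var_Y ^ 2 = monom 1 2" by (simp add: var_Y_def monom2_def monom_power)
  ultimately show False using assms by simp
qed

lemma exists_low_column:
  assumes "\<not> var_X ^ 2 dvd h"
  shows "\<exists>q\<in>supp h. fst q \<le> 1"
proof (rule ccontr)
  assume none: "\<not> ?thesis"
  have "coeff (coeff h b) a = 0" if "a < 2" for a b
    using none that by (force simp: supp_def coeff2_def)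
  then have "monom 1 2 dvd coeff h b" for b by (simp add: monom_1_dvd_iff')
  then have "[:monom 1 2:] dvd h" by (simp add: const_poly_dvd_iff)
  moreover have "var_X ^ 2 = [:monom 1 2:]"
    by (simp add: var_X_def monom2_def monom_0 power2_eq_square mult_monom numeral_2_eq_2)
  ultimately show False using assms by simp
qed

lemma exists_high_row:
  assumes "pderiv_Y h \<noteq> 0"
  shows "\<exists>q\<in>supp h. 1 \<le> snd q"
proof (rule ccontr)
  assume none: "\<not> ?thesis"
  have "pderiv_Y h = (\<Sum>q\<in>supp h. pderiv_Y (monom2 (coeffs2 h q) (fst q) (snd q)))"
    using pderiv_Y_sum monomial_sum_coeffs2 by metis
  also have "\<dots> = 0"
  proof (rule sum.neutral, rule ballI)
    fix q assume "q \<in> supp h"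
    then have "snd q = 0" using none by fastforce
    then show "pderiv_Y (monom2 (coeffs2 h q) (fst q) (snd q)) = 0"
      unfolding pderiv_Y_monom2 by (simp add: monom2_def)
  qed
  finally show False using assms by simp
qed

lemma exists_high_column:
  assumes "pderiv_X h \<noteq> 0"
  shows "\<exists>q\<in>supp h. 1 \<le> fst q"
proof (rule ccontr)
  assume none: "\<not> ?thesis"
  have "pderiv_X h = (\<Sum>q\<in>supp h. pderiv_X (monom2 (coeffs2 h q) (fst q) (snd q)))"
    using pderiv_X_sum monomial_sum_coeffs2 by metis
  also have "\<dots> = 0"
  proof (rule sum.neutral, rule ballI)
    fix q assume "q \<in> supp h"
    then have "fst q = 0" using none by fastforce
    then show "pderiv_X (monom2 (coeffs2 h q) (fst q) (snd q)) = 0"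
      unfolding pderiv_X_monom2 by (simp add: monom2_def)
  qed
  finally show False using assms by simp
qed

text \<open>
  Multiplication by \<open>x\<close> and \<open>y\<close> turns nondegeneracy on \<open>S\<close> into the form used in the lower bound.
\<close>

lemma nondegenerate_on_euler:
  assumes "nondegenerate_on h S" "x \<noteq> 0" "y \<noteq> 0" "B = {q \<in> supp h. real_point q \<in> S}"
  shows "(\<Sum>q\<in>B. of_nat (fst q) * coeffs2 h q * (x ^ fst q * y ^ snd q)) \<noteq> 0 \<or>
         (\<Sum>q\<in>B. of_nat (snd q) * coeffs2 h q * (x ^ fst q * y ^ snd q)) \<noteq> 0"
proof -
  have "initial_part h S = monomial_sum B (coeffs2 h)"
    unfolding initial_part_def assms(4) by (simp add: case_prod_unfold coeffs2_def)
  then have "(\<Sum>q\<in>B. of_nat (fst q) * coeffs2 h q * x ^ (fst q - 1) * y ^ snd q) \<noteq> 0 \<or>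
      (\<Sum>q\<in>B. of_nat (snd q) * coeffs2 h q * x ^ fst q * y ^ (snd q - 1)) \<noteq> 0"
    using assms(1-3) unfolding nondegenerate_on_def
    by (metis eval_pderiv_X_monomial_sum eval_pderiv_Y_monomial_sum)
  then show ?thesis
    unfolding euler_sum_X[symmetric] euler_sum_Y[symmetric] using assms(2,3) by simp
qed

lemma lojasiewicz_le_intercept:
  assumes "d \<in> intercepts (supp h) \<or> d \<in> intercepts (prod.swap ` supp h)"
  shows "lojasiewicz_infty (grad h) \<le> ereal d - 1"
  unfolding lojasiewicz_infty_def
proof (rule Sup_least, clarify)
  fix l c R :: real
  assume c: "0 < c"
    and lower: "\<forall>z. R \<le> max_norm z \<longrightarrow> c * max_norm z powr l \<le> max_norm (eval_map (grad h) z)"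
  let ?k = "coeffs2 h"
  have lower': "c * max (norm x) (norm y) powr l \<le>
      max (norm (partial_X ?k x y)) (norm (partial_Y ?k x y))"
    if "R \<le> max (norm x) (norm y)" for x y
    using lower[rule_format, of "(x, y)"] that by (simp add: max_norm_grad) (simp add: max_norm_def)
  from assms have "l \<le> d - 1"
  proof
    assume "d \<in> intercepts (supp h)"
    then show ?thesis
      using exponent_le_intercept[of ?k d c R l] c lower' finite_supp[of h]
      by (simp add: support_coeffs2)
  next
    assume "d \<in> intercepts (prod.swap ` supp h)"
    moreover have "c * max (norm x) (norm y) powr l \<le>
        max (norm (partial_X (?k \<circ> prod.swap) x y)) (norm (partial_Y (?k \<circ> prod.swap) x y))"
      if "R \<le> max (norm x) (norm y)" for x y
      using lower'[of y x] that unfolding partial_swap by (simp add: max.commute)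
    ultimately show ?thesis
      using exponent_le_intercept[of "?k \<circ> prod.swap" d c R l] c finite_supp[of h]
      by (simp add: support_swap support_coeffs2)
  qed
  then show "ereal l \<le> ereal d - 1" by (simp add: one_ereal_def)
qed

text \<open>
  The plane near infinity is the union of the regions \<open>|y| \<le> |x|\<close> and \<open>|x| \<le> |y|\<close>; the second one is the
  first one for \<open>h\<close> with its variables exchanged.
\<close>

lemma lojasiewicz_ge:
  assumes "coeff2 h 0 0 = 0" "pderiv_X h \<noteq> 0" "pderiv_Y h \<noteq> 0"
    and "\<not> var_X ^ 2 dvd h" "\<not> var_Y ^ 2 dvd h"
    and ne: "intercepts (supp h) \<noteq> {} \<or> intercepts (prod.swap ` supp h) \<noteq> {}"
    and nondeg: "nondegenerate_at_infinity h"
    and le: "\<And>d. d \<in> intercepts (supp h) \<union> intercepts (prod.swap ` supp h) \<Longrightarrow> l \<le> d - 1"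
  shows "ereal l \<le> lojasiewicz_infty (grad h)"
proof -
  let ?k = "coeffs2 h" and ?A = "supp h"
  let ?k' = "?k \<circ> prod.swap"
  have origin: "(0, 0) \<notin> ?A" using assms(1) by (simp add: supp_def)
  interpret right: nondegenerate_coefficients ?k l
  proof (unfold_locales, unfold support_coeffs2)
    fix \<theta> v w and x y :: complex
    assume vw: "v \<in> face ?A \<theta>" "w \<in> face ?A \<theta>" "snd v \<noteq> snd w" and xy: "x \<noteq> 0" "y \<noteq> 0"
    have "right_face ?A \<theta> \<in> right_polygon h"
      unfolding right_polygon_eq right_segments_def using aff_dim_right_face[OF finite_supp] vw by blast
    then have "nondegenerate_on h (right_face ?A \<theta>)"
      using nondeg unfolding nondegenerate_at_infinity_def by blast
    moreover have "face ?A \<theta> = {q \<in> ?A. real_point q \<in> right_face ?A \<theta>}"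
      using real_point_in_right_face face_subset by blast
    ultimately show "(\<Sum>q\<in>face ?A \<theta>. of_nat (fst q) * ?k q * (x ^ fst q * y ^ snd q)) \<noteq> 0 \<or>
        (\<Sum>q\<in>face ?A \<theta>. of_nat (snd q) * ?k q * (x ^ fst q * y ^ snd q)) \<noteq> 0"
      using xy by (intro nondegenerate_on_euler)
  qed (use finite_supp origin exists_low_row exists_high_row assms ne le in auto)
  interpret top: nondegenerate_coefficients ?k' l
  proof (unfold_locales, unfold support_swap support_coeffs2 swap_image_swap_image)
    fix \<theta> v w and x y :: complex
    let ?A' = "prod.swap ` ?A"
    assume vw: "v \<in> face ?A' \<theta>" "w \<in> face ?A' \<theta>" "snd v \<noteq> snd w" and xy: "x \<noteq> 0" "y \<noteq> 0"
    let ?S = "prod.swap ` right_face ?A' \<theta>"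
    have "finite ?A'" using finite_supp by simp
    then have "?S \<in> top_polygon h"
      unfolding top_polygon_eq right_segments_def using aff_dim_right_face[of ?A'] vw by auto
    then have "nondegenerate_on h ?S"
      using nondeg unfolding nondegenerate_at_infinity_def by blast
    moreover have "prod.swap ` face ?A' \<theta> = {q \<in> ?A. real_point q \<in> ?S}"
    proof -
      have "q \<in> prod.swap ` face ?A' \<theta> \<longleftrightarrow> q \<in> ?A \<and> real_point q \<in> ?S" for q
      proof -
        have "q \<in> prod.swap ` face ?A' \<theta> \<longleftrightarrow> prod.swap q \<in> face ?A' \<theta>" by force
        moreover have "real_point q \<in> ?S \<longleftrightarrow> real_point (prod.swap q) \<in> right_face ?A' \<theta>" by force
        moreover have "prod.swap q \<in> ?A' \<longleftrightarrow> q \<in> ?A"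
          by (rule inj_image_mem_iff[OF inj_swap])
        ultimately show ?thesis
          using real_point_in_right_face[of "prod.swap q" ?A' \<theta>] face_subset[of "prod.swap q" ?A' \<theta>]
          by blast
      qed
      then show ?thesis by blast
    qed
    ultimately have ne:
      "(\<Sum>q\<in>prod.swap ` face ?A' \<theta>. of_nat (fst q) * ?k q * (y ^ fst q * x ^ snd q)) \<noteq> 0 \<or>
       (\<Sum>q\<in>prod.swap ` face ?A' \<theta>. of_nat (snd q) * ?k q * (y ^ fst q * x ^ snd q)) \<noteq> 0"
      using xy by (intro nondegenerate_on_euler)
    have "(\<Sum>q\<in>prod.swap ` face ?A' \<theta>. of_nat (fst q) * ?k q * (y ^ fst q * x ^ snd q)) =
        (\<Sum>q\<in>face ?A' \<theta>. of_nat (snd q) * ?k' q * (x ^ fst q * y ^ snd q))"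
      by (subst sum.reindex) (simp_all add: inj_on_subset[OF inj_swap] mult.commute)
    moreover have "(\<Sum>q\<in>prod.swap ` face ?A' \<theta>. of_nat (snd q) * ?k q * (y ^ fst q * x ^ snd q)) =
        (\<Sum>q\<in>face ?A' \<theta>. of_nat (fst q) * ?k' q * (x ^ fst q * y ^ snd q))"
      by (subst sum.reindex) (simp_all add: inj_on_subset[OF inj_swap] mult.commute)
    ultimately show "(\<Sum>q\<in>face ?A' \<theta>. of_nat (fst q) * ?k' q * (x ^ fst q * y ^ snd q)) \<noteq> 0 \<or>
        (\<Sum>q\<in>face ?A' \<theta>. of_nat (snd q) * ?k' q * (x ^ fst q * y ^ snd q)) \<noteq> 0"
      using ne by argo
  qed (use finite_supp origin exists_low_column[of h] exists_high_column[of h] assms ne le in auto)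
  obtain c1 R1 where c1: "0 < c1" "\<And>x y. R1 \<le> norm x \<Longrightarrow> norm y \<le> norm x \<Longrightarrow>
      c1 * norm x powr l \<le> max_norm (eval_map (grad h) (x, y))"
    using right.gradient_lower_bound unfolding max_norm_grad by blast
  obtain c2 R2 where c2: "0 < c2" "\<And>y x. R2 \<le> norm y \<Longrightarrow> norm x \<le> norm y \<Longrightarrow>
      c2 * norm y powr l \<le> max_norm (eval_map (grad h) (x, y))"
    using top.gradient_lower_bound
    unfolding max_norm_grad partial_swap max.commute[of "norm (partial_Y ?k _ _)"] by blast
  have "min c1 c2 * max_norm z powr l \<le> max_norm (eval_map (grad h) z)"
    if z: "max R1 R2 \<le> max_norm z" for z
  proof -
    have le: "min c1 c2 * t \<le> c1 * t" "min c1 c2 * t \<le> c2 * t" if "0 \<le> t" for t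
      using that by (auto intro: mult_right_mono)
    obtain x y where xy: "z = (x, y)" by (cases z)
    show ?thesis
    proof (cases "norm y \<le> norm x")
      case True
      then have "max_norm z = norm x" by (simp add: xy max_norm_def)
      then show ?thesis using c1(2)[of x y] z True le(1)[of "norm x powr l"] by (simp add: xy)
    next
      case False
      then have "max_norm z = norm y" by (simp add: xy max_norm_def)
      then show ?thesis using c2(2)[of y x] z False le(2)[of "norm y powr l"] by (simp add: xy)
    qed
  qed
  then show ?thesis
    unfolding lojasiewicz_infty_def using c1(1) c2(1)
    by (intro Sup_upper CollectI exI[of _ l] conjI refl exI[of _ "min c1 c2"] exI[of _ "max R1 R2"]) auto
qed

theorem theorem2p1:
  fixes h :: bipoly
  assumes "coeff2 h 0 0 = 0"
    and "pderiv_X h \<noteq> 0" and "pderiv_Y h \<noteq> 0"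
    and "\<not> var_X ^ 2 dvd h" and "\<not> var_Y ^ 2 dvd h"
    and "(\<exists>S \<in> right_polygon h. \<not> exceptional_right S) \<or> (\<exists>S \<in> top_polygon h. \<not> exceptional_top S)"
  shows "lojasiewicz_infty (grad h) \<le>
           min (INF S \<in> {S \<in> right_polygon h. \<not> exceptional_right S}. ereal (alpha S))
               (INF S \<in> {S \<in> top_polygon h. \<not> exceptional_top S}. ereal (beta S)) - 1
         \<and> (nondegenerate_at_infinity h \<longrightarrow>
         lojasiewicz_infty (grad h) =
           min (INF S \<in> {S \<in> right_polygon h. \<not> exceptional_right S}. ereal (alpha S))
               (INF S \<in> {S \<in> top_polygon h. \<not> exceptional_top S}. ereal (beta S)) - 1)"
proof -
  let ?D = "intercepts (supp h)" and ?E = "intercepts (prod.swap ` supp h)"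
  let ?L = "lojasiewicz_infty (grad h)"
  have "(INF S \<in> {S \<in> right_polygon h. \<not> exceptional_right S}. ereal (alpha S)) = Inf (ereal ` ?D)"
    using alpha_image_right_polygon[OF finite_supp, of h] by (metis image_image)
  moreover have "(INF S \<in> {S \<in> top_polygon h. \<not> exceptional_top S}. ereal (beta S)) = Inf (ereal ` ?E)"
    using beta_image_top_polygon[OF finite_supp, of h] by (metis image_image)
  moreover define m where "m = Inf (ereal ` (?D \<union> ?E))"
  ultimately have m: "min (INF S \<in> {S \<in> right_polygon h. \<not> exceptional_right S}. ereal (alpha S))
               (INF S \<in> {S \<in> top_polygon h. \<not> exceptional_top S}. ereal (beta S)) = m"
    by (simp add: image_Un Inf_union_distrib inf_min)
  have ne: "?D \<union> ?E \<noteq> {}"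
    using assms(6) alpha_image_right_polygon[OF finite_supp, of h]
      beta_image_top_polygon[OF finite_supp, of h] by blast
  then obtain d where d: "d \<in> ?D \<union> ?E" by blast
  have upper: "?L \<le> m - 1"
  proof -
    have "?L + 1 \<le> m"
      unfolding m_def
    proof (rule Inf_greatest, clarify)
      fix d assume "d \<in> ?D \<union> ?E"
      then have "?L \<le> ereal d - 1" by (intro lojasiewicz_le_intercept) auto
      then show "?L + 1 \<le> ereal d" by (simp add: ereal_le_minus)
    qed
    then show ?thesis by (simp add: ereal_le_minus)
  qed
  have "m - 1 \<le> ?L" if "nondegenerate_at_infinity h"
  proof (cases m)
    case (real r)
    have "r - 1 \<le> d - 1" if "d \<in> ?D \<union> ?E" for d
    proof -
      have "m \<le> ereal d" unfolding m_def using that by (intro Inf_lower) auto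
      then show ?thesis using real by simp
    qed
    then have "ereal (r - 1) \<le> ?L"
      using ne that by (intro lojasiewicz_ge assms) auto
    then show ?thesis using real by (simp add: one_ereal_def)
  next
    case PInf
    have "m \<le> ereal d" unfolding m_def using d by (intro Inf_lower) auto
    then show ?thesis using PInf by simp
  qed (simp add: one_ereal_def)
  then show ?thesis unfolding m using upper by (auto intro: antisym)
qed

end
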